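(* Let $L$ be a metrizable compact $\operatorname{ANR}$-space embedded into the Hilbert cube $I^{\omega}$ as a $Z$-set. Then the following conditions are equivalent for any locally compact and Lindel\"{o}f space $X$: (a) $L \in \operatorname{AE}(\beta X \setminus X)$; (b) $I^{\omega} \setminus L \in \operatorname{AE}_{p}(X)$; (c) $\operatorname{Cone}(L)\setminus L \in \operatorname{AE}_{p}(X)$.
   Context: All spaces are Tychonov and all maps are continuous; $I=[0,1]$ and $\beta X$ is the Stone-Čech compactification of $X$. A map is proper if preimages of compact sets are compact. A subset $F\subset X$ is $C^{\ast}$-embedded in $X$ if every bounded continuous real-valued function on $F$ extends to a bounded continuous real-valued function on $X$. $Y\in\operatorname{AE}(X)$ means that every map $f\colon A\to Y$ defined on a closed subset $A\subset X$ extends to a map $X\to Y$. For locally compact $X$ and $Y$, $Y\in\operatorname{AE}_p(X)$ means that every proper map $f\colon A\to Y$ defined on a closed $C^{\ast}$-embedded subset $A$ of $X$ extends to a proper map $X\to Y$. In $\operatorname{Cone}(L)\setminus L$, the space $L$ is identified with the base $L\times\{0\}$ of the cone $\operatorname{Cone}(L)=L\times[0,1]/(L\times\{1\})$. A closed subset $A\subset I^\omega$ is a $Z$-set if the maps $f\colon I^\omega\to I^\omega$ with $f(I^\omega)\cap A=\emptyset$ are dense, in the topology of uniform convergence, in the space of all maps $I^\omega\to I^\omega$. *)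

theory Defs
  imports "HOL-Analysis.Analysis"
begin

section \<open>Extension properties\<close>

definition absolute_extensor :: "'b topology \<Rightarrow> 'a topology \<Rightarrow> bool"
  where "absolute_extensor Y X \<longleftrightarrow>
    (\<forall>A f. closedin X A \<and> continuous_map (subtopology X A) Y f \<longrightarrow>
       (\<exists>g. continuous_map X Y g \<and> (\<forall>x\<in>A. g x = f x)))"

text \<open>
  The library's \<open>proper_map\<close> means ``closed with compact fibres''; the notion below asks instead
  that preimages of compact sets be compact (and that the map be continuous).
\<close>

definition cpt_proper_map :: "'a topology \<Rightarrow> 'b topology \<Rightarrow> ('a \<Rightarrow> 'b) \<Rightarrow> bool"
  where "cpt_proper_map X Y f \<longleftrightarrow>
    continuous_map X Y f \<and> (\<forall>K. compactin Y K \<longrightarrow> compactin X {x \<in> topspace X. f x \<in> K})"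

definition Cstar_embedded :: "'a topology \<Rightarrow> 'a set \<Rightarrow> bool"
  where "Cstar_embedded X F \<longleftrightarrow> F \<subseteq> topspace X \<and>
    (\<forall>f. continuous_map (subtopology X F) euclideanreal f \<and> bounded (f ` F) \<longrightarrow>
       (\<exists>g. continuous_map X euclideanreal g \<and> bounded (g ` topspace X) \<and> (\<forall>x\<in>F. g x = f x)))"

definition proper_absolute_extensor :: "'b topology \<Rightarrow> 'a topology \<Rightarrow> bool"
  where "proper_absolute_extensor Y X \<longleftrightarrow>
    (\<forall>A f. closedin X A \<and> Cstar_embedded X A \<and> cpt_proper_map (subtopology X A) Y f \<longrightarrow>
       (\<exists>g. cpt_proper_map X Y g \<and> (\<forall>x\<in>A. g x = f x)))"

section \<open>Absolute neighbourhood retracts\<close>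

text \<open>
  A metrizable space is an ANR if it is a neighbourhood retract of every metrizable space that
  contains it as a closed subspace.  HOL cannot quantify over all types inside a definition, so the
  ambient space \<open>M\<close> has its points in \<^typ>\<open>nat \<times> 'a \<Rightarrow> real\<close>.  Nothing is lost: up to
  homeomorphism, these \<open>M\<close> include every separable metrizable space and also the convex hull of
  the image of \<open>L\<close> under Kuratowski's embedding into the bounded functions on \<open>L\<close>.  The image is
  closed in that hull (Wojdyslawski), and the hull is an absolute extensor for metrizable spaces
  (Dugundji), so being a neighbourhood retract of it already yields the property for all \<open>M\<close>.
\<close>

definition ANR_space :: "'a topology \<Rightarrow> bool"
  where "ANR_space L \<longleftrightarrow> metrizable_space L \<and>
    (\<forall>(M :: (nat \<times> 'a \<Rightarrow> real) topology) A.
       metrizable_space M \<and> closedin M A \<and> subtopology M A homeomorphic_space L \<longrightarrow>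
       (\<exists>U. openin M U \<and> A \<subseteq> U \<and> A retract_of_space subtopology M U))"

section \<open>The Hilbert cube and its Z-sets\<close>

definition hilbert_cube :: "(nat \<Rightarrow> real) topology"
  where "hilbert_cube = product_topology (\<lambda>_. top_of_set {0..1}) UNIV"

text \<open>
  \<^term>\<open>euclidean_metric\<close> on \<^typ>\<open>nat \<Rightarrow> real\<close> is the library's weighted product metric.  As the
  cube is compact, the topology of uniform convergence does not depend on the choice of metric.
\<close>

definition hilbert_cube_metric :: "(nat \<Rightarrow> real) metric"
  where "hilbert_cube_metric = submetric euclidean_metric (topspace hilbert_cube)"

lemma mtopology_of_hilbert_cube_metric: "mtopology_of hilbert_cube_metric = hilbert_cube"
proof -
  have "hilbert_cube = subtopology (product_topology (\<lambda>_. euclidean) UNIV) (\<Pi>\<^sub>E _\<in>UNIV. {0..1})"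
    unfolding hilbert_cube_def by (rule subtopology_product_topology [symmetric])
  then show ?thesis
    by (simp add: hilbert_cube_metric_def mtopology_of_submetric euclidean_product_topology
        hilbert_cube_def)
qed

definition Z_set :: "(nat \<Rightarrow> real) set \<Rightarrow> bool"
  where "Z_set A \<longleftrightarrow> closedin hilbert_cube A \<and>
    (let C = cfunspace hilbert_cube hilbert_cube_metric in
       mtopology_of C closure_of {f \<in> mspace C. f ` topspace hilbert_cube \<inter> A = {}} = mspace C)"

section \<open>The Stone-Cech compactification\<close>

text \<open>
  It is realised as the closure of the image of \<open>X\<close> under the evaluation map into the cube whose
  coordinates are indexed by the continuous functions from \<open>X\<close> to the unit interval.
\<close>

definition unit_functions :: "'a topology \<Rightarrow> ('a \<Rightarrow> real) set"
  where "unit_functions X = {f \<in> extensional (topspace X). continuous_map X (top_of_set {0..1}) f}"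

definition stone_cech_map :: "'a topology \<Rightarrow> 'a \<Rightarrow> ('a \<Rightarrow> real) \<Rightarrow> real"
  where "stone_cech_map X x = (\<lambda>f\<in>unit_functions X. f x)"

definition stone_cech :: "'a topology \<Rightarrow> (('a \<Rightarrow> real) \<Rightarrow> real) topology"
  where "stone_cech X =
    (let P = product_topology (\<lambda>_. top_of_set {0..1}) (unit_functions X)
     in subtopology P (P closure_of (stone_cech_map X ` topspace X)))"

definition stone_cech_remainder :: "'a topology \<Rightarrow> (('a \<Rightarrow> real) \<Rightarrow> real) topology"
  where "stone_cech_remainder X =
    subtopology (stone_cech X) (topspace (stone_cech X) - stone_cech_map X ` topspace X)"

section \<open>Cones\<close>

text \<open>
  The point \<^term>\<open>None\<close> is the vertex and \<^term>\<open>Some (x, t)\<close>, with \<open>t < 1\<close>, is the class of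
  \<open>(x, t)\<close>.  The cone carries the quotient topology; the cone over the empty space is a point.
\<close>

definition cone_proj :: "'a \<times> real \<Rightarrow> ('a \<times> real) option"
  where "cone_proj p = (if snd p = 1 then None else Some p)"

definition cone :: "'a topology \<Rightarrow> ('a \<times> real) option topology"
  where "cone L =
    (let P = prod_topology L (top_of_set {0..1}) in
     topology (\<lambda>U. U \<subseteq> insert None (cone_proj ` topspace P) \<and>
                   openin P {p \<in> topspace P. cone_proj p \<in> U}))"

definition cone_minus_base :: "'a topology \<Rightarrow> ('a \<times> real) option topology"
  where "cone_minus_base L =
    subtopology (cone L) (topspace (cone L) - cone_proj ` (topspace L \<times> {0}))"

lemma openin_cone:
  fixes L :: "'a topology"
  defines "P \<equiv> prod_topology L (top_of_set {0..1::real})"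
  shows "openin (cone L) U \<longleftrightarrow> U \<subseteq> insert None (cone_proj ` topspace P) \<and>
           openin P {p \<in> topspace P. cone_proj p \<in> U}"
proof -
  have "istopology (\<lambda>U. U \<subseteq> insert None (cone_proj ` topspace P) \<and>
           openin P {p \<in> topspace P. cone_proj p \<in> U})" (is "istopology ?T")
    unfolding istopology_def
  proof (intro conjI allI impI)
    fix S T assume S: "?T S" and T: "?T T"
    have "{p \<in> topspace P. cone_proj p \<in> S \<inter> T} =
        {p \<in> topspace P. cone_proj p \<in> S} \<inter> {p \<in> topspace P. cone_proj p \<in> T}"
      by auto
    moreover have "openin P ({p \<in> topspace P. cone_proj p \<in> S} \<inter> {p \<in> topspace P. cone_proj p \<in> T})"
      using S T by (intro openin_Int) simp_all
    ultimately show "openin P {p \<in> topspace P. cone_proj p \<in> S \<inter> T}"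
      by simp
    show "S \<inter> T \<subseteq> insert None (cone_proj ` topspace P)"
      using S by blast
  next
    fix \<K> assume K: "\<forall>S\<in>\<K>. ?T S"
    have "{p \<in> topspace P. cone_proj p \<in> \<Union>\<K>} = (\<Union>S\<in>\<K>. {p \<in> topspace P. cone_proj p \<in> S})"
      by auto
    moreover have "openin P (\<Union>S\<in>\<K>. {p \<in> topspace P. cone_proj p \<in> S})"
      using K by (intro openin_Union) auto
    ultimately show "openin P {p \<in> topspace P. cone_proj p \<in> \<Union>\<K>}"
      by simp
    show "\<Union>\<K> \<subseteq> insert None (cone_proj ` topspace P)"
      using K by blast
  qed
  then show ?thesis
    by (simp add: cone_def Let_def P_def)
qed

lemma topspace_cone:
  "topspace (cone L) = insert None (cone_proj ` (topspace L \<times> {0..1}))" (is "_ = ?C")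
proof
  have "openin (cone L) (topspace (cone L))"
    by simp
  then show "topspace (cone L) \<subseteq> ?C"
    unfolding openin_cone by simp
  have "{p \<in> topspace (prod_topology L (top_of_set {0..1::real})). cone_proj p \<in> ?C} =
      topspace (prod_topology L (top_of_set {0..1}))"
    by auto
  then have "openin (cone L) ?C"
    unfolding openin_cone by (simp only: openin_topspace) simp
  then show "?C \<subseteq> topspace (cone L)"
    by (rule openin_subset)
qed

lemma quotient_map_cone_proj:
  assumes "topspace L \<noteq> {}"
  shows "quotient_map (prod_topology L (top_of_set {0..1})) (cone L) cone_proj"
proof -
  obtain a where "a \<in> topspace L"
    using assms by blast
  then have "(None :: ('a \<times> real) option) \<in> cone_proj ` (topspace L \<times> {0..1})"
    by (force simp: cone_proj_def image_iff)
  then show ?thesis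
    unfolding quotient_map_def by (auto simp: topspace_cone openin_cone)
qed

end

theory Submission
  imports Defs
begin

text \<open>
  Both equivalences are instances of one criterion.  Let \<open>K\<close> be a compact Hausdorff absolute extensor
  and \<open>T \<subseteq> K\<close> a closed set that can be left instantly: there is a homotopy \<open>H\<close> on \<open>K\<close> with
  \<open>H\<^sub>0 = id\<close> whose later stages miss \<open>T\<close> (\<open>homotopy_Z_set\<close>).  Then, if \<open>T\<close> is a neighbourhood extensor,
  \<open>T\<close> is an absolute extensor for \<open>\<beta>X \<setminus> X\<close> if and only if \<open>K \<setminus> T\<close> is a proper absolute extensor
  for \<open>X\<close> (\<open>absolute_extensor_remainder_iff\<close>).

  The reason is that \<open>K\<close> compactifies \<open>K \<setminus> T\<close> with corona \<open>T\<close>: a map \<open>X \<rightarrow> K\<close> with values off \<open>T\<close>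
  is proper into \<open>K \<setminus> T\<close> exactly if its extension to \<open>\<beta>X\<close> sends the remainder into \<open>T\<close>.
  So proper maps induce maps from the remainder to \<open>T\<close>.  Conversely, a map \<open>h : \<beta>X \<rightarrow> K\<close> that sends the
  remainder to \<open>T\<close> becomes proper on \<open>X\<close> after replacing it by \<open>x \<mapsto> H (h x, v x)\<close>, where
  \<open>v \<ge> 0\<close> vanishes exactly on the remainder.  Such a \<open>v\<close> exists because \<open>X\<close> is locally compact and
  Lindelof, hence a countable union of cozero sets of \<open>\<beta>X\<close>.

  It remains to see that the two pairs of the theorem qualify.  In the Hilbert cube, maps that miss a
  Z-set and are close to the identity are joined by short polygonal paths, and composing with a still
  finer such map makes these paths miss the Z-set (\<open>Z_set_deformation_off\<close>).  In the cone, one moves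
  towards the vertex; that the cone over a compact ANR is an absolute extensor is
  \<open>absolute_extensor_cone\<close>.
\<close>

section \<open>The Stone-Cech compactification\<close>

abbreviation unit_cube :: "'i set \<Rightarrow> ('i \<Rightarrow> real) topology"
  where "unit_cube I \<equiv> product_topology (\<lambda>_. top_of_set {0..1}) I"

lemma compact_Hausdorff_unit_cube: "compact_space (unit_cube I) \<and> Hausdorff_space (unit_cube I)"
  by (auto simp: compact_space_product_topology Hausdorff_space_product_topology
      compact_space_subtopology Hausdorff_space_subtopology)

lemma stone_cech_map_in_cube:
  assumes "x \<in> topspace X"
  shows "stone_cech_map X x \<in> topspace (unit_cube (unit_functions X))"
  using assms by (auto simp: stone_cech_map_def unit_functions_def continuous_map_in_subtopology)

lemma compact_space_stone_cech: "compact_space (stone_cech X)"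
  using compact_Hausdorff_unit_cube[of "unit_functions X"]
  by (auto simp: stone_cech_def Let_def intro!: compact_space_subtopology closedin_compact_space)

lemma Hausdorff_space_stone_cech: "Hausdorff_space (stone_cech X)"
  using compact_Hausdorff_unit_cube[of "unit_functions X"]
  by (auto simp: stone_cech_def Let_def intro: Hausdorff_space_subtopology)

lemma normal_space_stone_cech: "normal_space (stone_cech X)"
  by (simp add: compact_Hausdorff_or_regular_imp_normal_space compact_space_stone_cech
      Hausdorff_space_stone_cech)

lemma stone_cech_map_image_subset:
  "stone_cech_map X ` topspace X \<subseteq> unit_cube (unit_functions X) closure_of (stone_cech_map X ` topspace X)"
  by (intro closure_of_subset image_subsetI stone_cech_map_in_cube)

lemma topspace_stone_cech:
  "topspace (stone_cech X) = unit_cube (unit_functions X) closure_of (stone_cech_map X ` topspace X)"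
  using closure_of_subset_topspace[of "unit_cube (unit_functions X)" "stone_cech_map X ` topspace X"]
  by (simp only: stone_cech_def Let_def topspace_subtopology) blast

lemma stone_cech_dense:
  "stone_cech X closure_of (stone_cech_map X ` topspace X) = topspace (stone_cech X)"
proof -
  let ?P = "unit_cube (unit_functions X)" and ?S = "stone_cech_map X ` topspace X"
  have "stone_cech X closure_of ?S = ?P closure_of ?S \<inter> ?P closure_of ?S"
    using stone_cech_map_image_subset[of X]
    by (simp only: stone_cech_def Let_def closure_of_subtopology Int_absorb1)
  then show ?thesis
    by (simp only: Int_absorb topspace_stone_cech)
qed

lemma embedding_stone_cech_map:
  assumes "completely_regular_space X" "Hausdorff_space X"
  shows "embedding_map X (stone_cech X) (stone_cech_map X)"
proof -
  have "mspace (submetric (cfunspace X euclidean_metric) {f. f \<in> topspace X \<rightarrow> {0..1::real}})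
        = unit_functions X"
    by (auto simp: unit_functions_def continuous_map_in_subtopology image_subset_iff_funcset
        intro: bounded_subset[OF bounded_closed_interval])
  then have "embedding_map X (unit_cube (unit_functions X)) (stone_cech_map X)"
    using completely_regular_space_cube_embedding_explicit[OF assms]
    by (simp add: stone_cech_map_def[abs_def])
  then show ?thesis
    using stone_cech_map_image_subset[of X]
    by (simp add: stone_cech_def Let_def embedding_map_in_subtopology)
qed

text \<open>
  The evaluation map is functorial: precomposition with \<open>g\<close> turns coordinates of the cube of \<open>K\<close> into
  coordinates of the cube of \<open>X\<close>.  A compact Hausdorff space \<open>K\<close> is closed in its own cube, so the
  map of cubes sends the closure of \<open>X\<close> into \<open>K\<close>.
\<close>

lemma stone_cech_extension:
  assumes "compact_space K" "Hausdorff_space K" and g: "continuous_map X K g"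
  obtains G where "continuous_map (stone_cech X) K G"
    "\<And>x. x \<in> topspace X \<Longrightarrow> G (stone_cech_map X x) = g x"
proof -
  let ?PX = "unit_cube (unit_functions X)" and ?PK = "unit_cube (unit_functions K)"
  let ?i = "stone_cech_map K"
  have "completely_regular_space K"
    by (simp add: assms compact_Hausdorff_or_regular_imp_normal_space
        normal_imp_completely_regular_space_gen)
  then have emb: "embedding_map K (stone_cech K) ?i"
    by (simp add: assms embedding_stone_cech_map)
  then have "embedding_map K ?PK ?i"
    by (simp add: stone_cech_def Let_def embedding_map_in_subtopology)
  then have hom: "homeomorphic_map K (subtopology ?PK (?i ` topspace K)) ?i"
    by (simp add: embedding_map_def)
  then obtain j where j: "homeomorphic_maps K (subtopology ?PK (?i ` topspace K)) ?i j"
    by (auto simp: homeomorphic_map_maps)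
  have "continuous_map K ?PK ?i"
    using j by (auto simp: homeomorphic_maps_def continuous_map_in_subtopology)
  then have "compactin ?PK (?i ` topspace K)"
    using assms(1) by (metis compact_space_def image_compactin)
  then have clo: "closedin ?PK (?i ` topspace K)"
    using compact_Hausdorff_unit_cube compactin_imp_closedin by blast
  define \<Phi> where "\<Phi> = (\<lambda>z. \<lambda>h\<in>unit_functions K. z (restrict (h \<circ> g) (topspace X)) :: real)"
  have *: "restrict (h \<circ> g) (topspace X) \<in> unit_functions X" if "h \<in> unit_functions K" for h
    using that g by (auto simp: unit_functions_def intro: continuous_map_compose
        continuous_map_eq[OF continuous_map_compose])
  have cont: "continuous_map ?PX ?PK \<Phi>"
    unfolding continuous_map_componentwise
    by (auto simp: \<Phi>_def intro!: continuous_map_product_projection *)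
  have \<Phi>: "\<Phi> (stone_cech_map X x) = ?i (g x)" if "x \<in> topspace X" for x
    using that * by (auto simp: \<Phi>_def stone_cech_map_def fun_eq_iff)
  have gK: "g ` topspace X \<subseteq> topspace K"
    using g by (rule continuous_map_image_subset_topspace)
  have "\<Phi> ` (stone_cech_map X ` topspace X) \<subseteq> ?i ` topspace K"
    using gK by (auto simp: \<Phi>)
  then have "?PK closure_of (\<Phi> ` (stone_cech_map X ` topspace X)) \<subseteq> ?i ` topspace K"
    using clo by (rule closure_of_minimal)
  then have "\<Phi> ` topspace (stone_cech X) \<subseteq> ?i ` topspace K"
    using continuous_map_image_closure_subset[OF cont, of "stone_cech_map X ` topspace X"]
    by (simp add: topspace_stone_cech)
  moreover have "continuous_map (stone_cech X) ?PK \<Phi>"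
    using cont by (simp add: stone_cech_def Let_def continuous_map_from_subtopology)
  ultimately have "continuous_map (stone_cech X) (subtopology ?PK (?i ` topspace K)) \<Phi>"
    by (auto intro!: continuous_map_into_subtopology)
  moreover have "continuous_map (subtopology ?PK (?i ` topspace K)) K j"
    using j by (simp add: homeomorphic_maps_def)
  ultimately have "continuous_map (stone_cech X) K (j \<circ> \<Phi>)"
    by (rule continuous_map_compose)
  moreover have "(j \<circ> \<Phi>) (stone_cech_map X x) = g x" if "x \<in> topspace X" for x
    using that j gK by (auto simp: \<Phi> homeomorphic_maps_def)
  ultimately show thesis
    by (rule that)
qed

section \<open>Proper maps and homeomorphic copies\<close>

lemma cpt_proper_map_compose:
  assumes "cpt_proper_map X Y f" "cpt_proper_map Y Z g"
  shows "cpt_proper_map X Z (g \<circ> f)"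
  unfolding cpt_proper_map_def
proof (intro conjI allI impI)
  have f: "continuous_map X Y f" and g: "continuous_map Y Z g"
    using assms by (auto simp: cpt_proper_map_def)
  then show "continuous_map X Z (g \<circ> f)"
    by (rule continuous_map_compose)
  fix K assume "compactin Z K"
  then have "compactin Y {y \<in> topspace Y. g y \<in> K}"
    using assms(2) by (simp add: cpt_proper_map_def)
  then have "compactin X {x \<in> topspace X. f x \<in> {y \<in> topspace Y. g y \<in> K}}"
    using assms(1) unfolding cpt_proper_map_def by blast
  moreover have "{x \<in> topspace X. f x \<in> {y \<in> topspace Y. g y \<in> K}} = {x \<in> topspace X. (g \<circ> f) x \<in> K}"
    using continuous_map_image_subset_topspace[OF f] by auto
  ultimately show "compactin X {x \<in> topspace X. (g \<circ> f) x \<in> K}"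
    by simp
qed

lemma homeomorphic_maps_imp_cpt_proper_map:
  assumes "homeomorphic_maps X Y f g"
  shows "cpt_proper_map X Y f"
  unfolding cpt_proper_map_def
proof (intro conjI allI impI)
  show "continuous_map X Y f"
    using assms by (simp add: homeomorphic_maps_def)
  fix K assume K: "compactin Y K"
  then have "compactin X (g ` K)"
    using assms by (auto simp: homeomorphic_maps_def intro: image_compactin)
  moreover have "g ` K = {x \<in> topspace X. f x \<in> K}"
  proof
    show "g ` K \<subseteq> {x \<in> topspace X. f x \<in> K}"
      using assms compactin_subset_topspace[OF K]
      by (auto simp: homeomorphic_maps_def continuous_map_def Pi_iff subset_iff)
    show "{x \<in> topspace X. f x \<in> K} \<subseteq> g ` K"
    proof clarify
      fix x assume "x \<in> topspace X" "f x \<in> K"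
      moreover have "g (f x) = x"
        using assms \<open>x \<in> topspace X\<close> by (simp add: homeomorphic_maps_def)
      ultimately show "x \<in> g ` K"
        by (metis imageI)
    qed
  qed
  ultimately show "compactin X {x \<in> topspace X. f x \<in> K}"
    by simp
qed

lemma cpt_proper_map_eq:
  assumes "cpt_proper_map X Y f" "\<And>x. x \<in> topspace X \<Longrightarrow> f x = g x"
  shows "cpt_proper_map X Y g"
proof -
  have "{x \<in> topspace X. g x \<in> K} = {x \<in> topspace X. f x \<in> K}" for K
    using assms(2) by auto
  then show ?thesis
    using assms by (simp add: cpt_proper_map_def continuous_map_eq[of X Y f g])
qed

lemma closedin_imp_Cstar_embedded:
  assumes "normal_space X" "closedin X A"
  shows "Cstar_embedded X A"
  unfolding Cstar_embedded_def
proof (intro conjI allI impI)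
  show "A \<subseteq> topspace X"
    using assms(2) by (rule closedin_subset)
  fix f :: "'a \<Rightarrow> real"
  assume f: "continuous_map (subtopology X A) euclideanreal f \<and> bounded (f ` A)"
  then obtain b where b: "\<And>x. x \<in> A \<Longrightarrow> \<bar>f x\<bar> \<le> b"
    by (auto simp: bounded_iff)
  have "f ` A \<subseteq> {- \<bar>b\<bar>..\<bar>b\<bar>}"
  proof clarify
    fix x assume "x \<in> A"
    then show "f x \<in> {- \<bar>b\<bar>..\<bar>b\<bar>}"
      using b[of x] by (auto simp: abs_if split: if_splits)
  qed
  then obtain g where g: "continuous_map X euclideanreal g" "\<And>x. x \<in> A \<Longrightarrow> g x = f x"
    "g ` topspace X \<subseteq> {- \<bar>b\<bar>..\<bar>b\<bar>}"
    using Tietze_extension_closed_real_interval[OF assms, of f "- \<bar>b\<bar>" "\<bar>b\<bar>"] f by auto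
  then have "bounded (g ` topspace X)"
    by (meson bounded_closed_interval bounded_subset)
  with g show "\<exists>g. continuous_map X euclideanreal g \<and> bounded (g ` topspace X) \<and> (\<forall>x\<in>A. g x = f x)"
    by blast
qed

lemma absolute_extensor_homeomorphic_target:
  assumes "Y homeomorphic_space Y'" "absolute_extensor Y X"
  shows "absolute_extensor Y' X"
  unfolding absolute_extensor_def
proof (intro allI impI)
  fix A f assume A: "closedin X A \<and> continuous_map (subtopology X A) Y' f"
  obtain i j where ij: "homeomorphic_maps Y Y' i j"
    using assms(1) by (auto simp: homeomorphic_space_def)
  then have "continuous_map (subtopology X A) Y (j \<circ> f)"
    using A by (auto simp: homeomorphic_maps_def intro: continuous_map_compose)
  then obtain g where g: "continuous_map X Y g" "\<forall>x\<in>A. g x = j (f x)"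
    using A assms(2) unfolding absolute_extensor_def by (metis comp_apply)
  have "f x \<in> topspace Y'" if "x \<in> A" for x
    using A that closedin_subset[of X A] by (auto simp: continuous_map_def Pi_iff)
  then have "\<forall>x\<in>A. (i \<circ> g) x = f x"
    using g ij by (auto simp: homeomorphic_maps_def)
  moreover have "continuous_map X Y' (i \<circ> g)"
    using g ij by (auto simp: homeomorphic_maps_def intro: continuous_map_compose)
  ultimately show "\<exists>g. continuous_map X Y' g \<and> (\<forall>x\<in>A. g x = f x)"
    by blast
qed

lemma proper_absolute_extensor_homeomorphic_source:
  assumes "X homeomorphic_space X'" "normal_space X" "proper_absolute_extensor Y X"
  shows "proper_absolute_extensor Y X'"
  unfolding proper_absolute_extensor_def
proof (intro allI impI)
  fix A f
  assume A: "closedin X' A \<and> Cstar_embedded X' A \<and> cpt_proper_map (subtopology X' A) Y f"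
  then have AX: "A \<subseteq> topspace X'"
    by (simp add: closedin_subset)
  obtain i j where ij: "homeomorphic_maps X X' i j"
    using assms(1) by (auto simp: homeomorphic_space_def)
  then have i: "continuous_map X X' i"
    by (simp add: homeomorphic_maps_def)
  define C where "C = {x \<in> topspace X. i x \<in> A}"
  have clC: "closedin X C"
    using A i unfolding C_def by (auto intro: closedin_continuous_map_preimage)
  have jC: "j y \<in> C" "i (j y) = y" if "y \<in> A" for y
    using that AX ij by (auto simp: C_def homeomorphic_maps_def continuous_map_def Pi_iff)
  have "homeomorphic_maps (subtopology X C) (subtopology X' A) i j"
    using ij jC AX by (intro homeomorphic_maps_subtopologies_alt) (auto simp: C_def)
  then have "cpt_proper_map (subtopology X C) Y (f \<circ> i)"
    using A by (auto intro: cpt_proper_map_compose homeomorphic_maps_imp_cpt_proper_map)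
  then obtain g where g: "cpt_proper_map X Y g" "\<forall>x\<in>C. g x = (f \<circ> i) x"
    using assms(3) clC closedin_imp_Cstar_embedded[OF assms(2) clC]
    unfolding proper_absolute_extensor_def by meson
  have "cpt_proper_map X' X j"
    using ij by (meson homeomorphic_maps_imp_cpt_proper_map homeomorphic_maps_sym)
  then have "cpt_proper_map X' Y (g \<circ> j)"
    using g(1) by (rule cpt_proper_map_compose)
  moreover have "\<forall>x\<in>A. (g \<circ> j) x = f x"
    using g(2) jC by auto
  ultimately show "\<exists>g. cpt_proper_map X' Y g \<and> (\<forall>x\<in>A. g x = f x)"
    by blast
qed

section \<open>Proper maps into the complement of a corona\<close>

text \<open>
  If \<open>h z\<close> were off \<open>T\<close>, a closed neighbourhood of \<open>h z\<close> that misses \<open>T\<close> would be compact in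
  \<open>K \<setminus> T\<close>.  Its preimage in \<open>A\<close> would be compact, hence closed in \<open>B\<close>, and could not accumulate at
  the point \<open>z\<close> outside \<open>A\<close>.
\<close>

lemma cpt_proper_map_boundary_in_corona:
  assumes "Hausdorff_space B" "A \<subseteq> topspace B"
    and "compact_space K" "Hausdorff_space K" "closedin K T"
    and h: "continuous_map B K h"
    and proper: "cpt_proper_map (subtopology B A) (subtopology K (topspace K - T)) h"
    and z: "z \<in> B closure_of A" "z \<notin> A"
  shows "h z \<in> T"
proof (rule ccontr)
  assume "h z \<notin> T"
  have zB: "z \<in> topspace B"
    using z(1) in_closure_of by fast
  then have "h z \<in> topspace K - T"
    using \<open>h z \<notin> T\<close> h by (auto simp: continuous_map_def)
  moreover have "regular_space K"
    using assms by (simp add: compact_Hausdorff_imp_regular_space)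
  ultimately obtain U V where UV: "openin K U" "openin K V" "h z \<in> U" "T \<subseteq> V" "disjnt U V"
    using \<open>closedin K T\<close> unfolding regular_space_def by meson
  define C where "C = topspace K - V"
  have "compactin K C"
    using assms UV by (simp add: C_def closedin_compact_space closedin_diff)
  then have "compactin (subtopology K (topspace K - T)) C"
    using UV by (auto simp: C_def compactin_subtopology)
  then have "compactin (subtopology B A) {x \<in> topspace (subtopology B A). h x \<in> C}"
    using proper by (simp add: cpt_proper_map_def)
  moreover have "{x \<in> topspace (subtopology B A). h x \<in> C} = {x \<in> A. h x \<in> C}"
    using \<open>A \<subseteq> topspace B\<close> by auto
  ultimately have clD: "closedin B {x \<in> A. h x \<in> C}"
    using \<open>Hausdorff_space B\<close> by (simp add: compactin_subtopology compactin_imp_closedin)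
  define W where "W = {x \<in> topspace B. h x \<in> U} - {x \<in> A. h x \<in> C}"
  have "openin B W"
    unfolding W_def using clD UV h by (auto intro: openin_diff openin_continuous_map_preimage)
  moreover have "z \<in> W"
    using z zB UV by (auto simp: W_def)
  ultimately obtain a where "a \<in> A" "a \<in> W"
    using z(1) unfolding in_closure_of by blast
  then show False
    using UV openin_subset[OF UV(1)] by (auto simp: W_def C_def disjnt_def)
qed

text \<open>
  A compact subset of \<open>K \<setminus> T\<close> is closed in \<open>K\<close>, so its preimage is closed in the compact set \<open>N\<close>;
  the preimage avoids \<open>N \<setminus> A\<close> because that part is sent into \<open>T\<close>.
\<close>

lemma cpt_proper_map_if_boundary_in_corona:
  assumes "compact_space B" "closedin B N" "A \<subseteq> N"
    and "Hausdorff_space K"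
    and h: "continuous_map (subtopology B N) K h"
    and inside: "\<And>x. x \<in> A \<Longrightarrow> h x \<notin> T" and bdry: "\<And>x. x \<in> N - A \<Longrightarrow> h x \<in> T"
  shows "cpt_proper_map (subtopology B A) (subtopology K (topspace K - T)) h"
  unfolding cpt_proper_map_def
proof (intro conjI allI impI)
  have hA: "continuous_map (subtopology B A) K h"
    using h \<open>A \<subseteq> N\<close> by (rule continuous_map_from_subtopology_mono)
  then show "continuous_map (subtopology B A) (subtopology K (topspace K - T)) h"
    using inside continuous_map_image_subset_topspace[OF hA]
    by (intro continuous_map_into_subtopology) auto
  fix C assume C: "compactin (subtopology K (topspace K - T)) C"
  then have CK: "closedin K C" "C \<inter> T = {}"
    using \<open>Hausdorff_space K\<close> by (auto simp: compactin_subtopology compactin_imp_closedin)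
  have NB: "N \<subseteq> topspace B"
    using \<open>closedin B N\<close> by (rule closedin_subset)
  have "closedin (subtopology B N) {x \<in> topspace (subtopology B N). h x \<in> C}"
    using h CK(1) by (rule closedin_continuous_map_preimage)
  then have "closedin B {x \<in> topspace (subtopology B N). h x \<in> C}"
    using \<open>closedin B N\<close> by (rule closedin_trans_full)
  with \<open>compact_space B\<close> have "compactin B {x \<in> topspace (subtopology B N). h x \<in> C}"
    by (rule closedin_compact_space)
  moreover have "{x \<in> topspace (subtopology B N). h x \<in> C} = {x \<in> topspace (subtopology B A). h x \<in> C}"
    using CK bdry \<open>A \<subseteq> N\<close> NB by auto
  ultimately show "compactin (subtopology B A) {x \<in> topspace (subtopology B A). h x \<in> C}"
    by (auto simp: compactin_subtopology)
qed

section \<open>Extension of maps over neighbourhoods and homotopy Z-sets\<close>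

definition absolute_neighbourhood_extensor :: "'b topology \<Rightarrow> 'a topology \<Rightarrow> bool"
  where "absolute_neighbourhood_extensor Y X \<longleftrightarrow>
    (\<forall>A f. closedin X A \<and> continuous_map (subtopology X A) Y f \<longrightarrow>
       (\<exists>U g. openin X U \<and> A \<subseteq> U \<and> continuous_map (subtopology X U) Y g \<and> (\<forall>x\<in>A. g x = f x)))"

text \<open>
  The homotopical form of being a Z-set.  Unlike the approximation property in the Hilbert cube, it can
  be read off directly for the base of a cone, and it turns any map into \<open>K\<close> into one that misses \<open>T\<close>
  wherever a given control function is positive.
\<close>

definition homotopy_Z_set :: "'a topology \<Rightarrow> 'a set \<Rightarrow> bool"
  where "homotopy_Z_set K T \<longleftrightarrow> closedin K T \<and>
    (\<exists>H. continuous_map (prod_topology K (top_of_set {0..1::real})) K H \<and>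
         (\<forall>x\<in>topspace K. H (x, 0) = x) \<and>
         (\<forall>x\<in>topspace K. \<forall>t\<in>{0<..1}. H (x, t) \<notin> T))"

lemma absolute_neighbourhood_extensor_homeomorphic_target:
  assumes "Y homeomorphic_space Y'" "absolute_neighbourhood_extensor Y X"
  shows "absolute_neighbourhood_extensor Y' X"
  unfolding absolute_neighbourhood_extensor_def
proof (intro allI impI)
  fix A f assume A: "closedin X A \<and> continuous_map (subtopology X A) Y' f"
  obtain i j where ij: "homeomorphic_maps Y Y' i j"
    using assms(1) by (auto simp: homeomorphic_space_def)
  then have "continuous_map (subtopology X A) Y (j \<circ> f)"
    using A by (auto simp: homeomorphic_maps_def intro: continuous_map_compose)
  then obtain U g where g: "openin X U" "A \<subseteq> U" "continuous_map (subtopology X U) Y g" "\<forall>x\<in>A. g x = j (f x)"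
    using A assms(2) unfolding absolute_neighbourhood_extensor_def by (metis comp_apply)
  have "f x \<in> topspace Y'" if "x \<in> A" for x
    using A that closedin_subset[of X A] by (auto simp: continuous_map_def Pi_iff)
  then have "\<forall>x\<in>A. (i \<circ> g) x = f x"
    using g ij by (auto simp: homeomorphic_maps_def)
  moreover have "continuous_map (subtopology X U) Y' (i \<circ> g)"
    using g ij by (auto simp: homeomorphic_maps_def intro: continuous_map_compose)
  ultimately show "\<exists>U g. openin X U \<and> A \<subseteq> U \<and> continuous_map (subtopology X U) Y' g \<and> (\<forall>x\<in>A. g x = f x)"
    using g by blast
qed

section \<open>Extension over the remainder and proper extension over the space\<close>

locale Lindelof_locally_compact_Tychonoff =
  fixes X :: "'x topology"
  assumes completely_regular: "completely_regular_space X" and Hausdorff: "Hausdorff_space X"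
    and locally_compact: "locally_compact_space X" and Lindelof: "Lindelof_space X"
begin

abbreviation \<beta>X :: "(('x \<Rightarrow> real) \<Rightarrow> real) topology"
  where "\<beta>X \<equiv> stone_cech X"

abbreviation S :: "(('x \<Rightarrow> real) \<Rightarrow> real) set"
  where "S \<equiv> stone_cech_map X ` topspace X"

lemma embedding: "embedding_map X \<beta>X (stone_cech_map X)"
  using completely_regular Hausdorff by (rule embedding_stone_cech_map)

lemma homeomorphic_image: "X homeomorphic_space subtopology \<beta>X S"
  using embedding by (rule embedding_map_imp_homeomorphic_space)

lemma S_subset: "S \<subseteq> topspace \<beta>X"
  using embedding by (metis continuous_map_image_subset_topspace continuous_map_into_fulltopology
      embedding_map_def homeomorphic_imp_continuous_map)

lemma topspace_S [simp]: "topspace (subtopology \<beta>X S) = S"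
  using S_subset by auto

lemma openin_S: "openin \<beta>X S"
  using locally_compact homeomorphic_locally_compact_space[OF homeomorphic_image]
  by (intro dense_locally_compact_openin_Hausdorff_space Hausdorff_space_stone_cech S_subset
      stone_cech_dense) simp

lemma normal_X: "normal_space X"
  using completely_regular Lindelof
  by (simp add: completely_regular_imp_regular_space regular_Lindelof_imp_normal_space)

lemma normal_S: "normal_space (subtopology \<beta>X S)"
  using normal_X homeomorphic_normal_space[OF homeomorphic_image] by simp

lemma Lindelof_S: "Lindelof_space (subtopology \<beta>X S)"
  using Lindelof embedding unfolding embedding_map_def
  by (metis Lindelof_space_continuous_map_image homeomorphic_eq_everything_map)

lemma extension_from_S:
  assumes "compact_space K" "Hausdorff_space K" "continuous_map (subtopology \<beta>X S) K g"
  obtains G where "continuous_map \<beta>X K G" "\<And>z. z \<in> S \<Longrightarrow> G z = g z"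
proof -
  have "continuous_map X (subtopology \<beta>X S) (stone_cech_map X)"
    using embedding by (simp add: embedding_map_def homeomorphic_imp_continuous_map)
  then have "continuous_map X K (g \<circ> stone_cech_map X)"
    using assms(3) by (rule continuous_map_compose)
  from stone_cech_extension[OF assms(1,2) this] that show thesis
    by (metis comp_apply imageE)
qed

text \<open>
  Every point of \<open>S\<close> lies in a cozero set of \<open>\<beta>X\<close> contained in the open set \<open>S\<close>, and by the Lindelof
  property countably many of these cover \<open>S\<close>.  The corresponding functions form one map to the space
  of real sequences, and the distance from the zero sequence combines them without summing a series.
\<close>

lemma exists_function_vanishing_at_infinity:
  obtains v where "continuous_map \<beta>X (top_of_set {0..1::real}) v"
    "\<And>z. z \<in> topspace \<beta>X \<Longrightarrow> v z = 0 \<longleftrightarrow> z \<notin> S"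
proof -
  have "\<exists>f. continuous_map \<beta>X (top_of_set {0..1::real}) f \<and> f z \<noteq> 0 \<and> (\<forall>y\<in>topspace \<beta>X - S. f y = 0)"
    if "z \<in> S" for z
  proof -
    have "closedin \<beta>X {z}" "closedin \<beta>X (topspace \<beta>X - S)"
      using that S_subset openin_S
      by (auto simp: Hausdorff_space_stone_cech closedin_Hausdorff_singleton)
    moreover have "disjnt (topspace \<beta>X - S) {z}"
      using that by simp
    ultimately obtain f where "continuous_map \<beta>X (top_of_set {0..1::real}) f"
      "f ` (topspace \<beta>X - S) \<subseteq> {0}" "f ` {z} \<subseteq> {1}"
      using Urysohn_lemma[OF normal_space_stone_cech, of X "topspace \<beta>X - S" "{z}" 0 1]
      by (metis zero_le_one)
    then show ?thesis
      by (intro exI[of _ f]) auto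
  qed
  then obtain f where f: "\<And>z. z \<in> S \<Longrightarrow> continuous_map \<beta>X (top_of_set {0..1::real}) (f z)"
    "\<And>z. z \<in> S \<Longrightarrow> f z z \<noteq> 0" "\<And>z y. z \<in> S \<Longrightarrow> y \<in> topspace \<beta>X - S \<Longrightarrow> f z y = 0"
    by metis
  define W where "W z = {y \<in> topspace (subtopology \<beta>X S). f z y \<in> - {0}}" for z
  have "openin (subtopology \<beta>X S) (W z)" if "z \<in> S" for z
    unfolding W_def
  proof (rule openin_continuous_map_preimage)
    show "continuous_map (subtopology \<beta>X S) euclideanreal (f z)"
      using f(1)[OF that] by (auto intro: continuous_map_from_subtopology simp: continuous_map_in_subtopology)
  qed auto
  moreover have "\<Union>(W ` S) = topspace (subtopology \<beta>X S)"
    using f(2) S_subset by (auto simp: W_def)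
  ultimately obtain \<V> where \<V>: "countable \<V>" "\<V> \<subseteq> W ` S" "\<Union>\<V> = topspace (subtopology \<beta>X S)"
    using Lindelof_S unfolding Lindelof_space_def by (metis (no_types, lifting) imageE)
  then obtain C where C: "countable C" "C \<subseteq> S" "\<Union>(W ` C) = S"
    by (metis countable_subset_image topspace_S)
  define \<Phi> :: "(('x \<Rightarrow> real) \<Rightarrow> real) \<Rightarrow> nat \<Rightarrow> real" where
    "\<Phi> y n = (if C = {} then 0 else f (from_nat_into C n) y)" for y n
  have "continuous_map \<beta>X euclideanreal (\<lambda>y. \<Phi> y n)" for n
    using f(1) C(2) from_nat_into[of C n]
    by (cases "C = {}") (auto simp: \<Phi>_def continuous_map_in_subtopology)
  then have "continuous_map \<beta>X euclidean \<Phi>"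
    by (subst euclidean_product_topology[symmetric]) (simp add: continuous_map_componentwise_UNIV)
  moreover have "continuous_map euclidean (top_of_set {0..1}) (\<lambda>y :: nat \<Rightarrow> real. min 1 (dist y (\<lambda>_. 0)))"
    by (auto simp: continuous_map_in_subtopology intro!: continuous_intros)
  ultimately have "continuous_map \<beta>X (top_of_set {0..1}) ((\<lambda>y. min 1 (dist y (\<lambda>_. 0))) \<circ> \<Phi>)"
    by (rule continuous_map_compose)
  moreover have "min 1 (dist (\<Phi> z) (\<lambda>_. 0)) = 0 \<longleftrightarrow> z \<notin> S" if z: "z \<in> topspace \<beta>X" for z
  proof
    assume "z \<notin> S"
    then have "\<Phi> z n = 0" for n
      using f(3)[of "from_nat_into C n" z] C(2) from_nat_into[of C n] z by (auto simp: \<Phi>_def)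
    then have "\<Phi> z = (\<lambda>_. 0)"
      by auto
    then show "min 1 (dist (\<Phi> z) (\<lambda>_. 0)) = 0"
      by simp
  next
    assume *: "min 1 (dist (\<Phi> z) (\<lambda>_. 0)) = 0"
    have \<Phi>0: "\<Phi> z = (\<lambda>_. 0)"
      using * by (auto simp: min_def split: if_splits)
    show "z \<notin> S"
    proof
      assume "z \<in> S"
      then have "z \<in> \<Union>(W ` C)"
        by (simp only: C(3))
      then obtain c where "c \<in> C" "z \<in> W c"
        by blast
      then have c: "c \<in> C" "f c z \<noteq> 0"
        by (simp_all add: W_def)
      obtain n where "from_nat_into C n = c"
        using from_nat_into_surj[OF C(1) c(1)] by blast
      then have "\<Phi> z n \<noteq> 0"
        using c by (auto simp: \<Phi>_def)
      then show False
        using \<Phi>0 by (auto dest: fun_cong)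
    qed
  qed
  ultimately show thesis
    by (intro that[of "(\<lambda>y. min 1 (dist y (\<lambda>_. 0))) \<circ> \<Phi>"]) simp_all
qed

lemma remainder_eq: "stone_cech_remainder X = subtopology \<beta>X (topspace \<beta>X - S)"
  by (simp add: stone_cech_remainder_def)

lemma closedin_remainder: "closedin \<beta>X (topspace \<beta>X - S)"
  using openin_S by auto

text \<open>
  A proper map on a closed set \<open>A\<close> sends the points of \<open>cl A\<close> at infinity into \<open>T\<close>, so the
  extension property of \<open>T\<close> yields a map of the whole remainder to \<open>T\<close>.  Extending over \<open>\<beta>X\<close> may
  create points of \<open>X\<close> that are sent into \<open>T\<close>; these are pushed off along the homotopy, for a time
  that vanishes at infinity and on \<open>A\<close>.
\<close>

lemma corona_extensor_imp_proper_extensor: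
  fixes K :: "'k topology"
  assumes K: "compact_space K" "Hausdorff_space K" and T: "homotopy_Z_set K T"
    and AE_S: "absolute_extensor K (subtopology \<beta>X S)" and AE_\<beta>X: "absolute_extensor K \<beta>X"
    and AE_T: "absolute_extensor (subtopology K T) (subtopology \<beta>X (topspace \<beta>X - S))"
  shows "proper_absolute_extensor (subtopology K (topspace K - T)) (subtopology \<beta>X S)"
  unfolding proper_absolute_extensor_def
proof (intro allI impI)
  fix A f
  let ?R = "topspace \<beta>X - S"
  assume A: "closedin (subtopology \<beta>X S) A \<and> Cstar_embedded (subtopology \<beta>X S) A \<and>
    cpt_proper_map (subtopology (subtopology \<beta>X S) A) (subtopology K (topspace K - T)) f"
  have AS: "A \<subseteq> S"
    using A by (metis closedin_subset topspace_S)
  then have sub: "subtopology (subtopology \<beta>X S) A = subtopology \<beta>X A"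
    by (simp add: subtopology_subtopology Int_absorb1)
  have clT: "closedin K T"
    using T by (simp add: homotopy_Z_set_def)
  have f: "cpt_proper_map (subtopology \<beta>X A) (subtopology K (topspace K - T)) f"
    using A sub by simp
  then have fK: "continuous_map (subtopology \<beta>X A) K f" and fT: "\<And>x. x \<in> A \<Longrightarrow> f x \<notin> T"
    using AS S_subset by (auto simp: cpt_proper_map_def continuous_map_in_subtopology)
  then obtain h0 where h0: "continuous_map (subtopology \<beta>X S) K h0" "\<And>x. x \<in> A \<Longrightarrow> h0 x = f x"
    using AE_S A sub unfolding absolute_extensor_def by metis
  then obtain h1 where h1: "continuous_map \<beta>X K h1" "\<And>x. x \<in> S \<Longrightarrow> h1 x = h0 x"
    using extension_from_S[OF K] by metis
  then have h1f: "h1 x = f x" if "x \<in> A" for x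
    using that AS h0(2) by auto
  define C where "C = \<beta>X closure_of A"
  have clC: "closedin \<beta>X C"
    by (simp add: C_def)
  have CS: "C \<inter> S = A"
    using A AS S_subset by (metis C_def closure_of_closedin closure_of_subtopology inf.absorb2 inf_commute)
  have "cpt_proper_map (subtopology \<beta>X A) (subtopology K (topspace K - T)) h1"
    using f by (rule cpt_proper_map_eq) (simp add: h1f)
  then have bdry: "h1 z \<in> T" if "z \<in> C" "z \<notin> S" for z
    using cpt_proper_map_boundary_in_corona[OF Hausdorff_space_stone_cech _ K clT h1(1), of A z]
      that AS S_subset by (auto simp: C_def)
  have "closedin \<beta>X (C \<inter> ?R)"
    using clC closedin_remainder by (rule closedin_Int)
  then have "closedin (subtopology \<beta>X ?R) (C \<inter> ?R)"
    by (rule closedin_subset_topspace) simp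
  moreover have "continuous_map (subtopology (subtopology \<beta>X ?R) (C \<inter> ?R)) (subtopology K T) h1"
    using h1(1) bdry
    by (auto simp: subtopology_subtopology continuous_map_in_subtopology intro: continuous_map_from_subtopology)
  ultimately obtain g where g: "continuous_map (subtopology \<beta>X ?R) (subtopology K T) g"
    "\<And>x. x \<in> C \<inter> ?R \<Longrightarrow> g x = h1 x"
    using AE_T unfolding absolute_extensor_def by metis
  define h2 where "h2 = (\<lambda>x. if x \<in> S then h1 x else g x)"
  have "continuous_map (subtopology \<beta>X (C \<union> ?R)) K h2"
  proof (rule pasting_lemma_closed[where I = "{True, False}" and T = "\<lambda>b. if b then C else ?R"
        and f = "\<lambda>b. if b then h1 else g"])
    show "closedin (subtopology \<beta>X (C \<union> ?R)) (if b then C else ?R)" for b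
      using clC closedin_remainder by (auto intro: closedin_subset_topspace)
    show "continuous_map (subtopology (subtopology \<beta>X (C \<union> ?R)) (if b then C else ?R)) K (if b then h1 else g)" for b
      using h1(1) g(1) by (auto simp: subtopology_subtopology Int_absorb1
          intro: continuous_map_from_subtopology continuous_map_into_fulltopology)
  qed (use g(2) in \<open>auto simp: h2_def\<close>)
  then obtain h where h: "continuous_map \<beta>X K h" "\<And>x. x \<in> C \<union> ?R \<Longrightarrow> h x = h2 x"
    using AE_\<beta>X closedin_Un[OF clC closedin_remainder] unfolding absolute_extensor_def by metis
  have hA: "h x = f x" if "x \<in> A" for x
    using that h(2) AS CS by (auto simp: h2_def h1f)
  have hR: "h x \<in> T" if "x \<in> ?R" for x
    using that h(2) g(1) by (auto simp: h2_def continuous_map_def)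
  \<comment> \<open>The points of \<open>S\<close> that have to be pushed off; they are separated from \<open>A\<close>, where nothing may move.\<close>
  define D where "D = {x \<in> topspace (subtopology \<beta>X S). h x \<in> T}"
  have "closedin (subtopology \<beta>X S) D"
    unfolding D_def by (rule closedin_continuous_map_preimage[OF continuous_map_from_subtopology[OF h(1)] clT])
  moreover have "disjnt A D"
    using hA fT by (auto simp: disjnt_def D_def)
  ultimately obtain u where u: "continuous_map (subtopology \<beta>X S) (top_of_set {0..1::real}) u"
    "u ` A \<subseteq> {0}" "u ` D \<subseteq> {1}"
    using Urysohn_lemma[OF normal_S, of A D 0 1] A by auto
  then obtain U where U: "continuous_map \<beta>X (top_of_set {0..1::real}) U" "\<And>x. x \<in> S \<Longrightarrow> U x = u x"
    using extension_from_S[of "top_of_set {0..1::real}" u]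
    by (metis Hausdorff_space_euclidean Hausdorff_space_subtopology compact_Icc compact_space_subtopology compactin_euclidean_iff)
  obtain v where v: "continuous_map \<beta>X (top_of_set {0..1::real}) v"
    "\<And>z. z \<in> topspace \<beta>X \<Longrightarrow> v z = 0 \<longleftrightarrow> z \<notin> S"
    using exists_function_vanishing_at_infinity by blast
  obtain H where H: "continuous_map (prod_topology K (top_of_set {0..1::real})) K H"
    "\<And>x. x \<in> topspace K \<Longrightarrow> H (x, 0) = x"
    "\<And>x t. x \<in> topspace K \<Longrightarrow> t \<in> {0<..1} \<Longrightarrow> H (x, t) \<notin> T"
    using T by (auto simp: homotopy_Z_set_def)
  define G where "G = (\<lambda>x. H (h x, U x * v x))"
  have U01: "U x \<in> {0..1}" and v01: "v x \<in> {0..1}" and hK: "h x \<in> topspace K" if "x \<in> topspace \<beta>X" for x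
    using that U(1) v(1) h(1) by (auto simp: continuous_map_def Pi_iff)
  have "continuous_map \<beta>X (top_of_set {0..1}) (\<lambda>x. U x * v x)"
    using U(1) v(1) U01 v01
    by (auto simp: continuous_map_in_subtopology mult_le_one intro!: continuous_map_real_mult)
  then have "continuous_map \<beta>X (prod_topology K (top_of_set {0..1})) (\<lambda>x. (h x, U x * v x))"
    using h(1) by (intro continuous_map_pairedI)
  then have G: "continuous_map \<beta>X K G"
    using continuous_map_compose[OF _ H(1)] by (simp add: G_def o_def)
  have "G x \<notin> T" if x: "x \<in> S" for x
  proof (cases "U x = 0")
    case True
    then have "x \<notin> D"
      using u(3) U(2)[OF x] by auto
    then show ?thesis
      using True x S_subset H(2) hK by (auto simp: G_def D_def)
  next
    case False
    then have "0 < U x * v x" "U x * v x \<le> 1"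
      using U01[of x] v01[of x] v(2)[of x] x S_subset by (auto simp: mult_le_one less_le)
    then show ?thesis
      using H(3) hK x S_subset by (auto simp: G_def)
  qed
  moreover have "G x \<in> T" if "x \<in> ?R" for x
    using that v(2)[of x] hR[of x] hK[of x] H(2) by (auto simp: G_def)
  ultimately have "cpt_proper_map (subtopology \<beta>X S) (subtopology K (topspace K - T)) G"
    using G S_subset
    by (intro cpt_proper_map_if_boundary_in_corona[where N = "topspace \<beta>X"] compact_space_stone_cech K)
      auto
  moreover have "G x = f x" if x: "x \<in> A" for x
  proof -
    have "x \<in> topspace \<beta>X" "U x = 0"
      using x u(2) U(2)[of x] AS S_subset by auto
    then show ?thesis
      using hA[OF x] hK[of x] H(2) by (simp add: G_def)
  qed
  ultimately show "\<exists>g. cpt_proper_map (subtopology \<beta>X S) (subtopology K (topspace K - T)) g \<and> (\<forall>x\<in>A. g x = f x)"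
    by blast
qed

text \<open>
  A map \<open>f\<close> into \<open>T\<close> on a closed part of the remainder extends over a closed neighbourhood \<open>N\<close> in
  \<open>\<beta>X\<close>; pushing it off \<open>T\<close> for a time that vanishes exactly at infinity gives a proper map on
  \<open>N \<inter> S\<close>.  A proper extension of it over \<open>S\<close> extends over \<open>\<beta>X\<close>, maps the remainder to \<open>T\<close>, and
  agrees with \<open>f\<close> because \<open>N \<inter> S\<close> accumulates at every point in the domain of \<open>f\<close>.
\<close>

lemma proper_extensor_imp_corona_extensor:
  fixes K :: "'k topology"
  assumes K: "compact_space K" "Hausdorff_space K" and T: "homotopy_Z_set K T"
    and ANE: "absolute_neighbourhood_extensor (subtopology K T) \<beta>X"
    and PAE: "proper_absolute_extensor (subtopology K (topspace K - T)) (subtopology \<beta>X S)"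
  shows "absolute_extensor (subtopology K T) (subtopology \<beta>X (topspace \<beta>X - S))"
  unfolding absolute_extensor_def
proof (intro allI impI)
  fix F f
  let ?R = "topspace \<beta>X - S"
  assume F: "closedin (subtopology \<beta>X ?R) F \<and> continuous_map (subtopology (subtopology \<beta>X ?R) F) (subtopology K T) f"
  have clF: "closedin \<beta>X F" and FR: "F \<subseteq> ?R"
    using F closedin_remainder closedin_trans_full closedin_subset[of "subtopology \<beta>X ?R" F] by auto
  then have "continuous_map (subtopology \<beta>X F) (subtopology K T) f"
    using F by (simp add: subtopology_subtopology Int_absorb1)
  then obtain W f' where W: "openin \<beta>X W" "F \<subseteq> W" "continuous_map (subtopology \<beta>X W) (subtopology K T) f'"
    "\<And>x. x \<in> F \<Longrightarrow> f' x = f x"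
    using ANE clF unfolding absolute_neighbourhood_extensor_def by metis
  then obtain O' where O': "openin \<beta>X O'" "F \<subseteq> O'" "\<beta>X closure_of O' \<subseteq> W"
    using normal_space_stone_cech[of X] clF unfolding normal_space_alt by metis
  define N where "N = \<beta>X closure_of O'"
  have clN: "closedin \<beta>X N"
    by (simp add: N_def)
  have NB: "N \<subseteq> topspace \<beta>X"
    using clN by (rule closedin_subset)
  have f'N: "continuous_map (subtopology \<beta>X N) (subtopology K T) f'"
    using W(3) O'(3) by (auto simp: N_def intro: continuous_map_from_subtopology_mono)
  then have f'T: "f' x \<in> T" "f' x \<in> topspace K" if "x \<in> N" for x
    using that NB by (auto simp: continuous_map_def Pi_iff)
  have clT: "closedin K T"
    using T by (simp add: homotopy_Z_set_def)
  obtain v where v: "continuous_map \<beta>X (top_of_set {0..1::real}) v"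
    "\<And>z. z \<in> topspace \<beta>X \<Longrightarrow> v z = 0 \<longleftrightarrow> z \<notin> S"
    using exists_function_vanishing_at_infinity by blast
  obtain H where H: "continuous_map (prod_topology K (top_of_set {0..1::real})) K H"
    "\<And>x. x \<in> topspace K \<Longrightarrow> H (x, 0) = x"
    "\<And>x t. x \<in> topspace K \<Longrightarrow> t \<in> {0<..1} \<Longrightarrow> H (x, t) \<notin> T"
    using T by (auto simp: homotopy_Z_set_def)
  define g where "g = (\<lambda>x. H (f' x, v x))"
  have "continuous_map (subtopology \<beta>X N) (prod_topology K (top_of_set {0..1})) (\<lambda>x. (f' x, v x))"
    using continuous_map_into_fulltopology[OF f'N] continuous_map_from_subtopology[OF v(1)]
    by (rule continuous_map_pairedI)
  then have g: "continuous_map (subtopology \<beta>X N) K g"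
    using continuous_map_compose[OF _ H(1)] by (simp add: g_def o_def)
  have v01: "v x \<in> {0..1}" if "x \<in> topspace \<beta>X" for x
    using that v(1) by (auto simp: continuous_map_def Pi_iff)
  have "g x \<notin> T" if "x \<in> N \<inter> S" for x
    using that v(2)[of x] v01[of x] NB f'T(2)[of x] H(3)[of "f' x" "v x"] by (auto simp: g_def less_le)
  moreover have gR: "g x = f' x" if "x \<in> N - N \<inter> S" for x
    using that v(2)[of x] NB f'T(2)[of x] H(2)[of "f' x"] by (auto simp: g_def)
  ultimately have "cpt_proper_map (subtopology \<beta>X (N \<inter> S)) (subtopology K (topspace K - T)) g"
    using f'T by (intro cpt_proper_map_if_boundary_in_corona[OF compact_space_stone_cech clN _ K(2) g]) auto
  then have "cpt_proper_map (subtopology (subtopology \<beta>X S) (N \<inter> S)) (subtopology K (topspace K - T)) g"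
    by (simp add: subtopology_subtopology Int_absorb1)
  moreover have clNS: "closedin (subtopology \<beta>X S) (N \<inter> S)"
    using clN by (auto simp: closedin_subtopology)
  ultimately obtain G0 where G0: "cpt_proper_map (subtopology \<beta>X S) (subtopology K (topspace K - T)) G0"
    "\<And>x. x \<in> N \<inter> S \<Longrightarrow> G0 x = g x"
    using PAE closedin_imp_Cstar_embedded[OF normal_S clNS] unfolding proper_absolute_extensor_def by metis
  then have "continuous_map (subtopology \<beta>X S) K G0"
    by (auto simp: cpt_proper_map_def intro: continuous_map_into_fulltopology)
  then obtain G where G: "continuous_map \<beta>X K G" "\<And>x. x \<in> S \<Longrightarrow> G x = G0 x"
    using extension_from_S[OF K] by metis
  have "cpt_proper_map (subtopology \<beta>X S) (subtopology K (topspace K - T)) G"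
    using G0(1) by (rule cpt_proper_map_eq) (simp add: G(2))
  then have GT: "G z \<in> T" if "z \<in> ?R" for z
    using cpt_proper_map_boundary_in_corona[OF Hausdorff_space_stone_cech S_subset K clT G(1)]
      that by (auto simp: stone_cech_dense)
  have "G x = f x" if x: "x \<in> F" for x
  proof -
    have "x \<in> O' \<inter> \<beta>X closure_of S"
      using x O' FR by (auto simp: stone_cech_dense)
    then have "x \<in> \<beta>X closure_of (O' \<inter> S)"
      using O'(1) openin_Int_closure_of_subset by fastforce
    then have "x \<in> \<beta>X closure_of (N \<inter> S)"
      using closure_of_mono[of "O' \<inter> S" "N \<inter> S" \<beta>X] closure_of_subset[OF openin_subset[OF O'(1)]]
      by (auto simp: N_def)
    moreover have xN: "x \<in> N"
      using x O'(2) closure_of_subset[OF openin_subset[OF O'(1)]] by (auto simp: N_def)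
    ultimately have "x \<in> subtopology \<beta>X N closure_of (N \<inter> S)"
      by (simp add: closure_of_subtopology Int_absorb1)
    then have "G x = g x"
      by (rule forall_in_closure_of_eq[OF _ K(2) _ g]) (use G G0 in \<open>auto intro: continuous_map_from_subtopology\<close>)
    then show ?thesis
      using gR[of x] xN x FR W(4) by auto
  qed
  moreover have "continuous_map (subtopology \<beta>X ?R) (subtopology K T) G"
    using G(1) GT by (auto simp: continuous_map_in_subtopology intro: continuous_map_from_subtopology)
  ultimately show "\<exists>g. continuous_map (subtopology \<beta>X ?R) (subtopology K T) g \<and> (\<forall>x\<in>F. g x = f x)"
    by blast
qed

theorem absolute_extensor_remainder_iff:
  fixes K :: "'k topology" and L :: "'l topology"
  assumes K: "compact_space K" "Hausdorff_space K" "homotopy_Z_set K T"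
    and AE: "absolute_extensor K (subtopology \<beta>X S)" "absolute_extensor K \<beta>X"
    and L: "L homeomorphic_space subtopology K T" "absolute_neighbourhood_extensor L \<beta>X"
  shows "absolute_extensor L (stone_cech_remainder X) \<longleftrightarrow>
    proper_absolute_extensor (subtopology K (topspace K - T)) X"
proof -
  have L': "subtopology K T homeomorphic_space L"
    using L(1) homeomorphic_space_sym by blast
  have L'ANE: "absolute_neighbourhood_extensor (subtopology K T) \<beta>X"
    using L by (rule absolute_neighbourhood_extensor_homeomorphic_target)
  have S': "subtopology \<beta>X S homeomorphic_space X"
    using homeomorphic_image homeomorphic_space_sym by blast
  have "absolute_extensor L (stone_cech_remainder X) \<longleftrightarrow>
      absolute_extensor (subtopology K T) (subtopology \<beta>X (topspace \<beta>X - S))"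
    unfolding remainder_eq
    by (rule iffI[OF absolute_extensor_homeomorphic_target[OF L(1)]
          absolute_extensor_homeomorphic_target[OF L']])
  also have "\<dots> \<longleftrightarrow> proper_absolute_extensor (subtopology K (topspace K - T)) (subtopology \<beta>X S)"
    by (rule iffI[OF corona_extensor_imp_proper_extensor[OF K AE]
          proper_extensor_imp_corona_extensor[OF K L'ANE]])
  also have "\<dots> \<longleftrightarrow> proper_absolute_extensor (subtopology K (topspace K - T)) X"
    by (rule iffI[OF proper_absolute_extensor_homeomorphic_source[OF S' normal_S]
          proper_absolute_extensor_homeomorphic_source[OF homeomorphic_image normal_X]])
  finally show ?thesis .
qed

end

section \<open>Z-sets in the Hilbert cube\<close>

definition cube :: "(nat \<Rightarrow> real) set"
  where "cube = {x. \<forall>n. x n \<in> {0..1}}"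

lemma hilbert_cube_eq: "hilbert_cube = top_of_set cube"
proof -
  have "hilbert_cube = subtopology (product_topology (\<lambda>_. euclidean) UNIV) (\<Pi>\<^sub>E _\<in>UNIV. {0..1})"
    unfolding hilbert_cube_def by (rule subtopology_product_topology [symmetric])
  moreover have "(\<Pi>\<^sub>E _\<in>(UNIV::nat set). {0..1::real}) = cube"
    by (auto simp: PiE_iff cube_def)
  ultimately show ?thesis
    by (simp add: euclidean_product_topology)
qed

lemma topspace_hilbert_cube [simp]: "topspace hilbert_cube = cube"
  by (simp add: hilbert_cube_eq)

lemma compact_space_hilbert_cube: "compact_space hilbert_cube"
  and Hausdorff_space_hilbert_cube: "Hausdorff_space hilbert_cube"
  using compact_Hausdorff_unit_cube by (auto simp: hilbert_cube_def)

lemma compact_cube: "compact cube"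
  using compact_space_hilbert_cube
  by (metis compact_space_def compactin_euclidean_iff compactin_subtopology hilbert_cube_eq topspace_hilbert_cube)

lemma continuous_map_hilbert_cube:
  "continuous_map Z hilbert_cube f \<longleftrightarrow> (\<forall>n. continuous_map Z (top_of_set {0..1}) (\<lambda>z. f z n))"
  by (simp add: hilbert_cube_def continuous_map_componentwise_UNIV)

lemma absolute_extensor_hilbert_cube:
  assumes "normal_space Z"
  shows "absolute_extensor hilbert_cube Z"
  unfolding absolute_extensor_def
proof (intro allI impI)
  fix A f assume A: "closedin Z A \<and> continuous_map (subtopology Z A) hilbert_cube f"
  have "\<exists>g. continuous_map Z (top_of_set {0..1}) g \<and> (\<forall>x\<in>A. g x = f x n)" for n
  proof -
    have "continuous_map (subtopology Z A) euclideanreal (\<lambda>x. f x n)" "(\<lambda>x. f x n) ` A \<subseteq> {0..1}"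
      using A closedin_subset[of Z A]
      by (auto simp: continuous_map_hilbert_cube continuous_map_in_subtopology Pi_iff)
    then obtain g where "continuous_map Z euclideanreal g" "\<And>x. x \<in> A \<Longrightarrow> g x = f x n" "g ` topspace Z \<subseteq> {0..1}"
      using Tietze_extension_closed_real_interval[OF assms, of A "\<lambda>x. f x n" 0 1] A by auto
    then show ?thesis
      by (auto simp: continuous_map_in_subtopology intro!: exI[of _ g])
  qed
  then obtain g where g: "\<And>n. continuous_map Z (top_of_set {0..1}) (g n)" "\<And>n x. x \<in> A \<Longrightarrow> g n x = f x n"
    by metis
  then have "continuous_map Z hilbert_cube (\<lambda>z n. g n z)"
    by (simp add: continuous_map_hilbert_cube)
  with g(2) show "\<exists>g. continuous_map Z hilbert_cube g \<and> (\<forall>x\<in>A. g x = f x)"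
    by (intro exI[of _ "\<lambda>z n. g n z"]) auto
qed

lemma Z_set_approximation:
  assumes "Z_set A" "\<epsilon> > 0"
  obtains p where "continuous_on cube p" "p ` cube \<subseteq> cube" "p ` cube \<inter> A = {}"
    "\<And>x. x \<in> cube \<Longrightarrow> dist (p x) x < \<epsilon>"
proof -
  let ?C = "cfunspace hilbert_cube hilbert_cube_metric"
  let ?S = "{f \<in> mspace ?C. f ` topspace hilbert_cube \<inter> A = {}}"
  have ms: "mspace ?C = {f. (\<forall>x\<in>cube. f x \<in> cube) \<and> f \<in> extensional cube \<and> continuous_map hilbert_cube hilbert_cube f}"
  proof -
    have "mspace hilbert_cube_metric = cube"
      by (simp add: hilbert_cube_metric_def)
    then show ?thesis
      using compactin_mspace_cfunspace[of hilbert_cube hilbert_cube_metric] compact_space_hilbert_cube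
      by (simp add: compact_space_def mtopology_of_hilbert_cube_metric)
  qed
  have id_C: "restrict id cube \<in> mspace ?C"
    unfolding ms by (auto intro: continuous_map_eq[OF continuous_map_id])
  then have "restrict id cube \<in> Metric_space.mtopology (mspace ?C) (mdist ?C) closure_of ?S"
    using assms(1) unfolding Z_set_def Let_def mtopology_of_def by blast
  then have "\<exists>p\<in>?S. p \<in> Metric_space.mball (mspace ?C) (mdist ?C) (restrict id cube) \<epsilon>"
    unfolding Metric_space.metric_closure_of[OF Metric_space_mspace_mdist] using assms(2) by blast
  then obtain p where p: "p \<in> ?S" "mdist ?C (restrict id cube) p < \<epsilon>"
    unfolding Metric_space.in_mball[OF Metric_space_mspace_mdist] by blast
  have p_C: "p \<in> mspace ?C"
    using p(1) by blast
  have "continuous_map hilbert_cube hilbert_cube p" and p_cube: "\<forall>x\<in>cube. p x \<in> cube"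
    and p_A: "p ` cube \<inter> A = {}"
    using p(1) unfolding ms topspace_hilbert_cube by blast+
  then have "continuous_on cube p"
    by (simp add: hilbert_cube_eq continuous_map_in_subtopology)
  then show thesis
  proof
    show "p ` cube \<subseteq> cube" "p ` cube \<inter> A = {}"
      using p_cube p_A by auto
    fix x assume x: "x \<in> cube"
    have "mdist hilbert_cube_metric (restrict id cube x) (p x) \<le> mdist ?C (restrict id cube) p"
      using x by (intro mdist_cfunspace_imp_mdist_le[OF id_C p_C order_refl]) simp
    then show "dist (p x) x < \<epsilon>"
      using p(2) x by (simp add: hilbert_cube_metric_def dist_commute)
  qed
qed

text \<open>
  On the cube the truncation at 1 in the product metric has no effect, so the metric is given there by
  a norm.  This is what makes balls convex.
\<close>

lemma sums_dist_cube:
  assumes "x \<in> cube" "y \<in> cube"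
  shows "(\<lambda>n. (1/2)^n * \<bar>x (from_nat n) - y (from_nat n)\<bar>) sums dist x y"
proof -
  have "x m \<in> {0..1}" "y m \<in> {0..1}" for m
    using assms by (auto simp: cube_def)
  then have le: "\<bar>x m - y m\<bar> \<le> 1" for m
    by (smt (verit) atLeastAtMost_iff)
  have "summable (\<lambda>n. (1/2)^n * \<bar>x (from_nat n) - y (from_nat n)\<bar>)"
  proof (rule summable_comparison_test')
    show "summable (\<lambda>n. (1/2::real)^n)"
      by (simp add: summable_geometric)
    show "norm ((1/2)^n * \<bar>x (from_nat n) - y (from_nat n)\<bar>) \<le> (1/2)^n" for n
      using mult_left_le[OF le, of "(1/2)^n" "from_nat n"] by (simp add: abs_mult)
  qed
  moreover have "dist x y = (\<Sum>n. (1/2)^n * \<bar>x (from_nat n) - y (from_nat n)\<bar>)"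
    unfolding dist_fun_def using le by (intro suminf_cong) (simp add: dist_real_def min_def)
  ultimately show ?thesis
    by (simp add: summable_sums)
qed

definition convex_comb :: "real \<Rightarrow> (nat \<Rightarrow> real) \<Rightarrow> (nat \<Rightarrow> real) \<Rightarrow> nat \<Rightarrow> real"
  where "convex_comb \<tau> a b n = (1 - \<tau>) * a n + \<tau> * b n"

lemma convex_comb_same [simp]: "convex_comb \<tau> a a = a"
  by (auto simp: convex_comb_def algebra_simps)

lemma convex_comb_in_cube:
  assumes "a \<in> cube" "b \<in> cube" "0 \<le> \<tau>" "\<tau> \<le> 1"
  shows "convex_comb \<tau> a b \<in> cube"
proof -
  have "(1 - \<tau>) * a n + \<tau> * b n \<in> {0..1}" for n
    using assms convex_bound_le[of "a n" 1 "b n" "1 - \<tau>" \<tau>] by (auto simp: cube_def)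
  then show ?thesis
    by (simp add: convex_comb_def cube_def)
qed

lemma dist_convex_comb_less:
  assumes "a \<in> cube" "b \<in> cube" "y \<in> cube" "0 \<le> \<tau>" "\<tau> \<le> 1"
    and "dist a y < \<delta>" "dist b y < \<delta>"
  shows "dist (convex_comb \<tau> a b) y < \<delta>"
proof -
  have "dist (convex_comb \<tau> a b) y \<le> (1 - \<tau>) * dist a y + \<tau> * dist b y"
  proof (rule sums_le)
    show "(\<lambda>n. (1/2)^n * \<bar>convex_comb \<tau> a b (from_nat n) - y (from_nat n)\<bar>) sums dist (convex_comb \<tau> a b) y"
      using assms convex_comb_in_cube by (intro sums_dist_cube) auto
    show "(\<lambda>n. (1 - \<tau>) * ((1/2)^n * \<bar>a (from_nat n) - y (from_nat n)\<bar>)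
        + \<tau> * ((1/2)^n * \<bar>b (from_nat n) - y (from_nat n)\<bar>)) sums ((1 - \<tau>) * dist a y + \<tau> * dist b y)"
      using assms by (intro sums_add sums_mult sums_dist_cube)
    fix n
    let ?m = "from_nat n"
    have "convex_comb \<tau> a b ?m - y ?m = (1 - \<tau>) * (a ?m - y ?m) + \<tau> * (b ?m - y ?m)"
      by (simp add: convex_comb_def algebra_simps)
    then have "\<bar>convex_comb \<tau> a b ?m - y ?m\<bar> \<le> (1 - \<tau>) * \<bar>a ?m - y ?m\<bar> + \<tau> * \<bar>b ?m - y ?m\<bar>"
      using assms abs_triangle_ineq[of "(1 - \<tau>) * (a ?m - y ?m)" "\<tau> * (b ?m - y ?m)"]
      by (simp add: abs_mult)
    then have "(1/2)^n * \<bar>convex_comb \<tau> a b ?m - y ?m\<bar>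
        \<le> (1/2)^n * ((1 - \<tau>) * \<bar>a ?m - y ?m\<bar> + \<tau> * \<bar>b ?m - y ?m\<bar>)"
      by (intro mult_left_mono) auto
    then show "(1/2)^n * \<bar>convex_comb \<tau> a b ?m - y ?m\<bar>
        \<le> (1 - \<tau>) * ((1/2)^n * \<bar>a ?m - y ?m\<bar>) + \<tau> * ((1/2)^n * \<bar>b ?m - y ?m\<bar>)"
      by (simp add: algebra_simps)
  qed
  also have "\<dots> < \<delta>"
    using assms by (intro convex_bound_lt) auto
  finally show ?thesis .
qed

text \<open>
  The path that is at \<open>F j x\<close> at each integer time \<open>j\<close> and linear in between.
\<close>

definition polygonal :: "(nat \<Rightarrow> 'a \<Rightarrow> nat \<Rightarrow> real) \<Rightarrow> 'a \<Rightarrow> real \<Rightarrow> nat \<Rightarrow> real"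
  where "polygonal F x s = convex_comb (s - real (nat \<lfloor>s\<rfloor>)) (F (nat \<lfloor>s\<rfloor>) x) (F (Suc (nat \<lfloor>s\<rfloor>)) x)"

text \<open>
  The case distinction by the integer part of \<open>s\<close> hides continuity at integer times; a finite sum of
  hat functions makes it visible.
\<close>

lemma polygonal_eq_hat_sum:
  assumes "0 \<le> s" "s < real N"
  shows "polygonal F x s n = (\<Sum>i\<le>N. max 0 (1 - \<bar>s - real i\<bar>) * F i x n)"
proof -
  define j where "j = nat \<lfloor>s\<rfloor>"
  have j: "real j \<le> s" "s < real j + 1" "j < N"
    using assms by (auto simp: j_def) linarith+
  have "(\<Sum>i\<le>N. max 0 (1 - \<bar>s - real i\<bar>) * F i x n) = (\<Sum>i\<in>{j, Suc j}. max 0 (1 - \<bar>s - real i\<bar>) * F i x n)"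
  proof (rule sum.mono_neutral_right)
    show "\<forall>i\<in>{..N} - {j, Suc j}. max 0 (1 - \<bar>s - real i\<bar>) * F i x n = 0"
    proof
      fix i assume "i \<in> {..N} - {j, Suc j}"
      then have "i < j \<or> Suc (Suc j) \<le> i"
        by auto
      then have "real i + 1 \<le> real j \<or> real j + 2 \<le> real i"
        by (auto simp: Suc_le_eq)
      then have "max 0 (1 - \<bar>s - real i\<bar>) = 0"
        using j by (auto simp: max_def abs_if)
      then show "max 0 (1 - \<bar>s - real i\<bar>) * F i x n = 0"
        by simp
    qed
  qed (use j in auto)
  also have "\<dots> = polygonal F x s n"
    using j by (simp add: polygonal_def convex_comb_def flip: j_def)
  finally show ?thesis ..
qed

lemma continuous_on_polygonal:
  assumes F: "\<And>i. continuous_on D (\<lambda>p. F i (a p))" and s: "continuous_on D s"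
    and "\<And>p. p \<in> D \<Longrightarrow> 0 \<le> s p \<and> s p < real N"
  shows "continuous_on D (\<lambda>p. polygonal F (a p) (s p))"
proof (rule continuous_on_coordinatewise_then_product)
  fix n
  have "continuous_on D (\<lambda>p. \<Sum>i\<le>N. max 0 (1 - \<bar>s p - real i\<bar>) * F i (a p) n)"
    using F s by (intro continuous_intros) (auto dest: continuous_on_product_then_coordinatewise)
  then show "continuous_on D (\<lambda>p. polygonal F (a p) (s p) n)"
    by (rule continuous_on_eq) (simp add: assms(3) polygonal_eq_hat_sum[of _ N])
qed

lemma compact_closed_separated:
  fixes S :: "'a::metric_space set"
  assumes "compact S" "closed A" "S \<inter> A = {}"
  shows "\<exists>\<delta>>0. \<forall>x\<in>S. \<forall>a\<in>A. \<delta> \<le> dist x a"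
proof (cases "S = {} \<or> A = {}")
  case True
  then show ?thesis
    by (auto intro: exI[of _ 1])
next
  case False
  have "continuous_on S (\<lambda>x. infdist x A)"
    by (intro continuous_intros)
  then obtain y where y: "y \<in> S" "\<And>x. x \<in> S \<Longrightarrow> infdist y A \<le> infdist x A"
    using continuous_attains_inf[OF assms(1)] False by blast
  have "infdist y A > 0"
    using infdist_pos_not_in_closed[OF assms(2)] y(1) assms(3) False by blast
  moreover have "infdist y A \<le> dist x a" if "x \<in> S" "a \<in> A" for x a
    using y(2)[OF that(1)] infdist_le[OF that(2), of x] by simp
  ultimately show ?thesis
    by blast
qed

text \<open>
  Let \<open>f k\<close> and \<open>g k\<close> be maps off \<open>A\<close> that tend to the identity, the \<open>g k\<close> much faster.  The linear
  path from \<open>f k\<close> to \<open>f (k + 1)\<close> may cross \<open>A\<close>, but applying \<open>g k\<close> to it removes it from \<open>A\<close>.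
  To pass from \<open>g (k - 1)\<close> to \<open>g k\<close>, one waits at \<open>f k\<close>, whose image has a positive distance \<open>\<delta> k\<close>
  from \<open>A\<close>: both maps move points by less than \<open>\<delta> k\<close>, so the linear path between them stays off \<open>A\<close>.
\<close>

lemma Z_set_deformation_off:
  assumes A: "Z_set A"
  shows "\<exists>h. (\<forall>N. continuous_on (cube \<times> {0..<real N}) (\<lambda>(x, s). h x s)) \<and>
    (\<forall>x\<in>cube. \<forall>s\<ge>0. h x s \<in> cube - A) \<and>
    (\<forall>\<epsilon>>0. \<exists>s0. \<forall>s\<ge>s0. \<forall>x\<in>cube. dist (h x s) x < \<epsilon>)"
proof -
  have "closedin hilbert_cube A"
    using A by (simp add: Z_set_def)
  then have clA: "closed A"
    unfolding hilbert_cube_eq using compact_imp_closed[OF compact_cube] by (rule closedin_closed_trans)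
  have "\<exists>p. continuous_on cube p \<and> (\<forall>x\<in>cube. p x \<in> cube \<and> p x \<notin> A \<and> dist (p x) x < \<epsilon>)"
    if "\<epsilon> > 0" for \<epsilon>
  proof -
    obtain p where "continuous_on cube p" "p ` cube \<subseteq> cube" "p ` cube \<inter> A = {}"
      "\<And>x. x \<in> cube \<Longrightarrow> dist (p x) x < \<epsilon>"
      using Z_set_approximation[OF A \<open>\<epsilon> > 0\<close>] by metis
    then show ?thesis
      by (intro exI[of _ p]) blast
  qed
  then obtain p where p: "\<And>\<epsilon>. \<epsilon> > 0 \<Longrightarrow> continuous_on cube (p \<epsilon>)"
    "\<And>\<epsilon> x. \<epsilon> > 0 \<Longrightarrow> x \<in> cube \<Longrightarrow> p \<epsilon> x \<in> cube" "\<And>\<epsilon> x. \<epsilon> > 0 \<Longrightarrow> x \<in> cube \<Longrightarrow> p \<epsilon> x \<notin> A"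
    "\<And>\<epsilon> x. \<epsilon> > 0 \<Longrightarrow> x \<in> cube \<Longrightarrow> dist (p \<epsilon> x) x < \<epsilon>"
    by metis
  define f where "f k = p (1 / real (Suc k))" for k
  have "\<exists>\<delta>>0. \<forall>x\<in>cube. \<forall>a\<in>A. \<delta> \<le> dist (f k x) a" for k
  proof -
    have "compact (f k ` cube)" "f k ` cube \<inter> A = {}"
      using p by (auto simp: f_def compact_cube intro!: compact_continuous_image)
    then show ?thesis
      using compact_closed_separated[of "f k ` cube" A] clA by blast
  qed
  then obtain \<delta> where \<delta>: "\<And>k. \<delta> k > 0" "\<And>k x a. x \<in> cube \<Longrightarrow> a \<in> A \<Longrightarrow> \<delta> k \<le> dist (f k x) a"
    by metis
  \<comment> \<open>\<open>g k\<close> is used while waiting at \<open>f k\<close> and again at \<open>f (Suc k)\<close>, so it has to respect both distances.\<close>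
  define \<eta> where "\<eta> k = min (1 / real (Suc k)) (min (\<delta> k) (\<delta> (Suc k)))" for k
  have \<eta>: "\<eta> k > 0" for k
    using \<delta>(1) by (simp add: \<eta>_def)
  define g where "g k = p (\<eta> k)" for k
  \<comment> \<open>\<open>F\<close> rests at \<open>f k\<close> during \<open>[2k, 2k + 1]\<close>, and \<open>G\<close> rests at \<open>g k\<close> during \<open>[2k + 1, 2k + 2]\<close>;
    truncated subtraction makes \<open>G\<close> rest at \<open>g 0\<close> during \<open>[0, 1]\<close> as well.\<close>
  define F where "F j = f (j div 2)" for j
  define G where "G j = g ((j - 1) div 2)" for j
  have f: "continuous_on cube (f k)" "x \<in> cube \<Longrightarrow> f k x \<in> cube" "x \<in> cube \<Longrightarrow> dist (f k x) x < 1 / real (Suc k)" for k x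
    using p by (auto simp: f_def)
  have g: "continuous_on cube (g k)" "x \<in> cube \<Longrightarrow> g k x \<in> cube" "x \<in> cube \<Longrightarrow> g k x \<notin> A"
    "x \<in> cube \<Longrightarrow> dist (g k x) x < \<eta> k" for k x
    using p \<eta> by (auto simp: g_def)
  have F_cube: "F i x \<in> cube" if "x \<in> cube" for i x
    using that f(2) by (simp add: F_def)
  have G_cube: "G i x \<in> cube" if "x \<in> cube" for i x
    using that g(2) by (simp add: G_def)
  define h where "h x s = polygonal G (polygonal F x s) s" for x s
  have step: "\<exists>j \<tau>. nat \<lfloor>s\<rfloor> = j \<and> 0 \<le> \<tau> \<and> \<tau> \<le> 1 \<and> s < real j + 1 \<and>
      polygonal F x s = convex_comb \<tau> (F j x) (F (Suc j) x) \<and>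
      (\<forall>y. polygonal G y s = convex_comb \<tau> (G j y) (G (Suc j) y))" if "s \<ge> 0" for x s
    using that by (intro exI[of _ "nat \<lfloor>s\<rfloor>"] exI[of _ "s - real (nat \<lfloor>s\<rfloor>)"]) (auto simp: polygonal_def; linarith)
  have polyF: "polygonal F x s \<in> cube" if "x \<in> cube" "s \<ge> 0" for x s
    using step[OF that(2), of x] that f(2) by (auto simp: F_def intro!: convex_comb_in_cube)
  have polyG: "polygonal G y s \<in> cube" if "y \<in> cube" "s \<ge> 0" for y s
    using step[OF that(2), of undefined] that g(2) by (auto simp: G_def intro!: convex_comb_in_cube)
  have "h x s \<notin> A" if x: "x \<in> cube" and s: "s \<ge> 0" for x s
  proof -
    obtain j \<tau> where \<tau>: "0 \<le> \<tau>" "\<tau> \<le> 1" and Fs: "polygonal F x s = convex_comb \<tau> (F j x) (F (Suc j) x)"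
      and Gs: "\<And>y. polygonal G y s = convex_comb \<tau> (G j y) (G (Suc j) y)"
      using step[OF s] by blast
    show ?thesis
    proof (cases "even j")
      case True
      then obtain k where k: "j = 2 * k"
        by blast
      have y: "polygonal F x s = f k x" "f k x \<in> cube"
        using Fs f(2)[OF x] by (simp_all add: F_def k)
      have "dist (G j (f k x)) (f k x) < \<delta> k" "dist (G (Suc j) (f k x)) (f k x) < \<delta> k"
      proof -
        show "dist (G (Suc j) (f k x)) (f k x) < \<delta> k"
          using g(4)[OF y(2), of k] by (simp add: G_def k \<eta>_def)
        show "dist (G j (f k x)) (f k x) < \<delta> k"
        proof (cases k)
          case 0
          then show ?thesis
            using g(4)[OF y(2), of k] by (simp add: G_def k \<eta>_def)
        next
          case (Suc i)
          then have "(j - 1) div 2 = i"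
            using k by simp
          then show ?thesis
            using g(4)[OF y(2), of i] Suc by (simp add: G_def \<eta>_def)
        qed
      qed
      then have "dist (h x s) (f k x) < \<delta> k"
        using g(2)[OF y(2)] y \<tau> by (simp add: h_def Gs) (auto simp: G_def intro!: dist_convex_comb_less)
      then show ?thesis
        using \<delta>(2)[OF x, of "h x s" k] by (auto simp: dist_commute)
    next
      case False
      then obtain k where k: "j = 2 * k + 1"
        by (elim oddE)
      then have "h x s = g k (polygonal F x s)"
        by (simp add: h_def Gs G_def)
      then show ?thesis
        using g(3) polyF[OF x s] by simp
    qed
  qed
  moreover have "\<exists>s0. \<forall>s\<ge>s0. \<forall>x\<in>cube. dist (h x s) x < \<epsilon>" if \<epsilon>: "\<epsilon> > 0" for \<epsilon>
  proof -
    obtain K where "inverse (real (Suc K)) < \<epsilon> / 2"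
      using reals_Archimedean half_gt_zero[OF \<epsilon>] by blast
    then have K: "2 / real (Suc K) < \<epsilon>"
      by (simp add: inverse_eq_divide del: of_nat_Suc)
    have "dist (h x s) x < \<epsilon>" if s: "s \<ge> 2 * real K + 2" and x: "x \<in> cube" for s x
    proof -
      obtain j \<tau> where "nat \<lfloor>s\<rfloor> = j" and \<tau>: "0 \<le> \<tau>" "\<tau> \<le> 1" "s < real j + 1" and Fs: "polygonal F x s = convex_comb \<tau> (F j x) (F (Suc j) x)"
        and Gs: "\<And>y. polygonal G y s = convex_comb \<tau> (G j y) (G (Suc j) y)"
        using step[of s x] s by auto
      then have "real (2 * K + 1) < real j"
        using s by simp
      then have j: "2 * K + 1 < j"
        by linarith
      have le: "1 / real (Suc k) \<le> 1 / real (Suc K)" if "K \<le> k" for k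
        using that by (simp add: field_simps)
      have "dist (F i x) x < 1 / real (Suc K)" if "2 * K \<le> i" for i
      proof -
        have "K \<le> i div 2"
          using that by linarith
        then show ?thesis
          using f(3)[OF x, of "i div 2"] le[of "i div 2"] unfolding F_def by linarith
      qed
      then have 1: "dist (polygonal F x s) x < 1 / real (Suc K)"
        unfolding Fs using j F_cube[OF x] x \<tau> by (intro dist_convex_comb_less) (auto simp del: of_nat_Suc)
      let ?y = "polygonal F x s"
      have y: "?y \<in> cube"
        using polyF[OF x] s by simp
      have "dist (G i ?y) ?y < 1 / real (Suc K)" if "2 * K + 1 \<le> i" for i
      proof -
        have "K \<le> (i - 1) div 2"
          using that by linarith
        then show ?thesis
          using g(4)[OF y, of "(i - 1) div 2"] le[of "(i - 1) div 2"] unfolding G_def \<eta>_def by linarith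
      qed
      then have "dist (h x s) ?y < 1 / real (Suc K)"
        unfolding h_def Gs using j G_cube[OF y] y \<tau> by (intro dist_convex_comb_less) (auto simp del: of_nat_Suc)
      then have "dist (h x s) x < 1 / real (Suc K) + 1 / real (Suc K)"
        using 1 dist_triangle[of "h x s" x ?y] by linarith
      then show ?thesis
        using K by simp
    qed
    then show ?thesis
      by blast
  qed
  moreover have "continuous_on (cube \<times> {0..<real N}) (\<lambda>(x, s). h x s)" for N
  proof -
    let ?D = "cube \<times> {0..<real N}"
    have snd: "continuous_on ?D snd"
      by (rule continuous_on_snd) simp
    have "continuous_on ?D (\<lambda>q. F i (fst q))" for i
      unfolding F_def by (rule continuous_on_compose2[OF f(1) continuous_on_fst]) auto
    from continuous_on_polygonal[where N = N and F = F and a = fst, OF this snd]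
    have "continuous_on ?D (\<lambda>q. polygonal F (fst q) (snd q))"
      by auto
    then have "continuous_on ?D (\<lambda>q. G i (polygonal F (fst q) (snd q)))" for i
      unfolding G_def by (rule continuous_on_compose2[OF g(1)]) (use polyF in auto)
    from continuous_on_polygonal[where N = N and F = G and a = "\<lambda>q. polygonal F (fst q) (snd q)", OF this snd]
    have "continuous_on ?D (\<lambda>q. polygonal G (polygonal F (fst q) (snd q)) (snd q))"
      by auto
    then show ?thesis
      by (simp add: h_def case_prod_unfold)
  qed
  ultimately show ?thesis
    using polyF polyG by (intro exI[of _ h]) (auto simp: h_def)
qed

text \<open>
  The deformation tends uniformly to the identity as \<open>s \<rightarrow> \<infinity>\<close>, so with \<open>s = 1 / t\<close> it extends
  continuously to \<open>t = 0\<close> by the identity.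
\<close>

theorem Z_set_imp_homotopy_Z_set:
  assumes A: "Z_set A"
  shows "homotopy_Z_set hilbert_cube A"
proof -
  obtain h where cont: "\<And>N. continuous_on (cube \<times> {0..<real N}) (\<lambda>(x, s). h x s)"
    and off: "\<And>x s. x \<in> cube \<Longrightarrow> s \<ge> 0 \<Longrightarrow> h x s \<in> cube - A"
    and lim: "\<And>\<epsilon>. \<epsilon> > 0 \<Longrightarrow> \<exists>s0. \<forall>s\<ge>s0. \<forall>x\<in>cube. dist (h x s) x < \<epsilon>"
    using Z_set_deformation_off[OF A] by blast
  define H where "H = (\<lambda>(x, t). if t = 0 then x else h x (1 / t))"
  let ?D = "cube \<times> {0..1::real}"
  have "continuous (at q within ?D) H" if q: "q \<in> ?D" for q
  proof -
    obtain x t where q_eq: "q = (x, t)"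
      by (cases q)
    then have x: "x \<in> cube" and t: "0 \<le> t" "t \<le> 1"
      using q by auto
    show ?thesis
    proof (cases "t = 0")
      case True
      show ?thesis
        unfolding continuous_within_eps_delta
      proof (intro allI impI)
        fix \<epsilon> :: real assume "\<epsilon> > 0"
        then obtain s0 where s0: "\<And>s y. s \<ge> s0 \<Longrightarrow> y \<in> cube \<Longrightarrow> dist (h y s) y < \<epsilon> / 2"
          using lim[of "\<epsilon> / 2"] by auto
        define d where "d = min (\<epsilon> / 2) (1 / (\<bar>s0\<bar> + 1))"
        have "d > 0"
          using \<open>\<epsilon> > 0\<close> by (simp add: d_def)
        moreover have "dist (H r) (H q) < \<epsilon>" if r: "r \<in> ?D" "dist r q < d" for r
        proof -
          obtain y u where r_eq: "r = (y, u)"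
            by (cases r)
          then have y: "y \<in> cube" and u: "0 \<le> u"
            using r by auto
          have yx: "dist y x < \<epsilon> / 2" and ud: "u < 1 / (\<bar>s0\<bar> + 1)"
            using r(2) dist_fst_le[of r q] dist_snd_le[of r q] u True
            by (auto simp: r_eq q_eq d_def dist_real_def)
          have "dist (H r) y < \<epsilon> / 2"
          proof (cases "u = 0")
            case True
            then show ?thesis
              using \<open>\<epsilon> > 0\<close> by (simp add: H_def r_eq)
          next
            case False
            then have "\<bar>s0\<bar> + 1 < 1 / u"
              using ud u by (simp add: field_simps)
            then show ?thesis
              using False s0[OF _ y, of "1 / u"] by (simp add: H_def r_eq)
          qed
          then show ?thesis
            using yx dist_triangle[of "H r" x y] True by (simp add: H_def q_eq)
        qed
        ultimately show "\<exists>d>0. \<forall>r\<in>?D. dist r q < d \<longrightarrow> dist (H r) (H q) < \<epsilon>"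
          by blast
      qed
    next
      case False
      then have t0: "t > 0"
        using t by simp
      obtain N where N: "1 / t < real N"
        using reals_Archimedean2 by blast
      then have N0: "real N > 0"
        using t0 by (smt (verit) divide_pos_pos)
      define V where "V = (UNIV :: (nat \<Rightarrow> real) set) \<times> {1 / real N<..}"
      have V: "open V" "q \<in> V"
        using N t0 N0 by (auto simp: V_def q_eq open_Times field_simps)
      have pos: "0 < b" if "1 / real N < b" for b
        using N0 that by (smt (verit) divide_pos_pos)
      then have V_eq: "?D \<inter> V = cube \<times> {1 / real N<..1}"
        by (auto simp: V_def intro: less_imp_le[OF pos])
      have "continuous_on (cube \<times> {1 / real N<..1}) (\<lambda>r. case (fst r, 1 / snd r) of (x, s) \<Rightarrow> h x s)"
      proof (rule continuous_on_compose2[OF cont[of N]])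
        have *: "0 < snd r" if "r \<in> cube \<times> {1 / real N<..1}" for r
          using that pos by auto
        then show "continuous_on (cube \<times> {1 / real N<..1}) (\<lambda>r. (fst r, 1 / snd r))"
          by (intro continuous_intros) fastforce
        show "(\<lambda>r. (fst r, 1 / snd r)) ` (cube \<times> {1 / real N<..1}) \<subseteq> cube \<times> {0..<real N}"
          using pos N0 by (auto simp: less_imp_le divide_less_eq mult.commute)
      qed
      then have "continuous_on (?D \<inter> V) H"
        unfolding V_eq
        by (rule continuous_on_eq) (use N0 in \<open>auto simp: H_def\<close>)
      then have "continuous (at q within ?D \<inter> V) H"
        using q V(2) by (auto simp: continuous_on_eq_continuous_within)
      moreover have "at q within ?D \<inter> V = at q within ?D"
        using V by (intro at_within_nhd[of q V]) auto
      ultimately show ?thesis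
        by simp
    qed
  qed
  then have "continuous_on ?D H"
    by (simp add: continuous_on_eq_continuous_within)
  moreover have in_cube: "H (x, t) \<in> cube" if "x \<in> cube" "t \<in> {0..1}" for x t
    using that off[of x "1 / t"] by (auto simp: H_def)
  ultimately have "continuous_map (prod_topology hilbert_cube (top_of_set {0..1})) hilbert_cube H"
    by (auto simp: hilbert_cube_eq continuous_map_in_subtopology simp flip: subtopology_Times)
  moreover have "H (x, t) \<notin> A" if "x \<in> cube" "t \<in> {0<..1}" for x t
    using that off[of x "1 / t"] by (auto simp: H_def)
  moreover have "H (x, 0) = x" for x
    by (simp add: H_def)
  ultimately show ?thesis
    using A unfolding homotopy_Z_set_def Z_set_def by (intro conjI exI[of _ H]) auto
qed

section \<open>Compact ANRs as neighbourhood extensors\<close>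

text \<open>
  The definition of an ANR speaks about ambient spaces whose points are functions on \<open>nat \<times> 'l\<close>, so the
  cube is first copied there as the functions that ignore the second argument.
\<close>

lemma ANR_neighbourhood_retraction:
  fixes L :: "'l topology"
  assumes L: "ANR_space L" "compact_space L" and e: "embedding_map L hilbert_cube e"
  obtains U r where "openin hilbert_cube U" "e ` topspace L \<subseteq> U"
    "continuous_map (subtopology hilbert_cube U) L r" "\<And>x. x \<in> topspace L \<Longrightarrow> r (e x) = x"
proof -
  define \<phi> :: "(nat \<Rightarrow> real) \<Rightarrow> nat \<times> 'l \<Rightarrow> real" where "\<phi> x = (\<lambda>p. x (fst p))" for x
  define \<psi> :: "(nat \<times> 'l \<Rightarrow> real) \<Rightarrow> nat \<Rightarrow> real" where "\<psi> y = (\<lambda>n. y (n, undefined))" for y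
  have \<psi>\<phi> [simp]: "\<psi> (\<phi> x) = x" for x
    by (simp add: \<phi>_def \<psi>_def)
  define M where "M = top_of_set (\<phi> ` cube)"
  have "continuous_on S \<phi>" for S
    unfolding \<phi>_def by (intro continuous_on_coordinatewise_then_product)
      (auto intro: continuous_on_subset[OF continuous_on_product_coordinates])
  moreover have "continuous_on S \<psi>" for S
    unfolding \<psi>_def by (intro continuous_on_coordinatewise_then_product)
      (auto intro: continuous_on_subset[OF continuous_on_product_coordinates])
  ultimately have hom: "homeomorphic_maps hilbert_cube M \<phi> \<psi>"
    by (auto simp: homeomorphic_maps_def M_def hilbert_cube_eq continuous_map_in_subtopology)
  then have \<phi>: "homeomorphic_map hilbert_cube M \<phi>"
    by (auto simp: homeomorphic_map_maps)
  define A where "A = \<phi> ` e ` topspace L"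
  have "metrizable_space hilbert_cube"
    by (simp add: hilbert_cube_eq metrizable_space_subtopology metrizable_space_euclidean)
  then have M: "metrizable_space M"
    using hom homeomorphic_metrizable_space homeomorphic_space_def by blast
  have emb: "embedding_map L M (\<phi> \<circ> e)"
    using \<phi> by (intro embedding_map_compose[OF e]) (simp flip: surjective_embedding_map)
  have LA: "L homeomorphic_space subtopology M A"
    using embedding_map_imp_homeomorphic_space[OF emb] by (simp add: A_def image_comp)
  have "continuous_map L M (\<phi> \<circ> e)"
    using emb by (metis continuous_map_in_subtopology embedding_map_def homeomorphic_imp_continuous_map)
  then have "compactin M A"
    using L(2) unfolding A_def image_comp compact_space_def by (rule image_compactin[rotated])
  then have "closedin M A"
    using M by (simp add: compactin_imp_closedin metrizable_imp_Hausdorff_space)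
  moreover have "subtopology M A homeomorphic_space L"
    using LA homeomorphic_space_sym by blast
  ultimately obtain U' where U': "openin M U'" "A \<subseteq> U'" "A retract_of_space subtopology M U'"
    using L(1) M unfolding ANR_space_def by blast
  then obtain r' where r': "continuous_map (subtopology M U') (subtopology (subtopology M U') A) r'"
    "\<And>x. x \<in> A \<Longrightarrow> r' x = x"
    unfolding retract_of_space_def by blast
  obtain j where j: "homeomorphic_maps L (subtopology M A) (\<phi> \<circ> e) j"
    using emb by (auto simp: embedding_map_def homeomorphic_map_maps A_def image_comp)
  define U where "U = {x \<in> topspace hilbert_cube. \<phi> x \<in> U'}"
  have c\<phi>: "continuous_map hilbert_cube M \<phi>"
    using hom by (simp add: homeomorphic_maps_def)
  have eL: "e ` topspace L \<subseteq> topspace hilbert_cube"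
    using e by (metis continuous_map_image_subset_topspace continuous_map_in_subtopology embedding_map_def homeomorphic_imp_continuous_map)
  show thesis
  proof
    show "openin hilbert_cube U"
      unfolding U_def using c\<phi> U'(1) by (rule openin_continuous_map_preimage)
    show "e ` topspace L \<subseteq> U"
      using eL U'(2) by (auto simp: U_def A_def)
    have "continuous_map (subtopology hilbert_cube U) (subtopology M U') \<phi>"
      using c\<phi> by (auto simp: continuous_map_in_subtopology U_def intro: continuous_map_from_subtopology)
    moreover have "continuous_map (subtopology M U') (subtopology M A) r'"
      using r'(1) U'(2) by (simp add: subtopology_subtopology Int_absorb1)
    moreover have "continuous_map (subtopology M A) L j"
      using j by (simp add: homeomorphic_maps_def)
    ultimately show "continuous_map (subtopology hilbert_cube U) L (j \<circ> r' \<circ> \<phi>)"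
      by (metis continuous_map_compose comp_assoc)
    show "(j \<circ> r' \<circ> \<phi>) (e x) = x" if "x \<in> topspace L" for x
      using that j r'(2) by (simp add: A_def homeomorphic_maps_def)
  qed
qed

lemma absolute_neighbourhood_extensor_ANR:
  assumes L: "ANR_space L" "compact_space L" and e: "embedding_map L hilbert_cube e"
    and "normal_space Z"
  shows "absolute_neighbourhood_extensor L Z"
  unfolding absolute_neighbourhood_extensor_def
proof (intro allI impI)
  fix A f assume A: "closedin Z A \<and> continuous_map (subtopology Z A) L f"
  obtain U r where U: "openin hilbert_cube U" "e ` topspace L \<subseteq> U"
    and r: "continuous_map (subtopology hilbert_cube U) L r" "\<And>x. x \<in> topspace L \<Longrightarrow> r (e x) = x"
    using ANR_neighbourhood_retraction[OF L e] by metis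
  have "continuous_map L hilbert_cube e"
    using e by (metis continuous_map_in_subtopology embedding_map_def homeomorphic_imp_continuous_map)
  then have "continuous_map (subtopology Z A) hilbert_cube (e \<circ> f)"
    using A by (auto intro: continuous_map_compose)
  then obtain g where g: "continuous_map Z hilbert_cube g" "\<And>x. x \<in> A \<Longrightarrow> g x = e (f x)"
    using absolute_extensor_hilbert_cube[OF assms(4)] A unfolding absolute_extensor_def by (metis comp_apply)
  define W where "W = {z \<in> topspace Z. g z \<in> U}"
  have fA: "f x \<in> topspace L" if "x \<in> A" for x
    using A that closedin_subset[of Z A] by (auto simp: continuous_map_def Pi_iff)
  have "openin Z W"
    unfolding W_def using g(1) U(1) by (rule openin_continuous_map_preimage)
  moreover have "A \<subseteq> W"
    using A closedin_subset[of Z A] g(2) fA U(2) by (auto simp: W_def)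
  moreover have "continuous_map (subtopology Z W) (subtopology hilbert_cube U) g"
    using g(1) by (auto simp: continuous_map_in_subtopology W_def intro: continuous_map_from_subtopology)
  then have "continuous_map (subtopology Z W) L (r \<circ> g)"
    using r(1) by (rule continuous_map_compose)
  moreover have "\<forall>x\<in>A. (r \<circ> g) x = f x"
    using g(2) r(2) fA by simp
  ultimately show "\<exists>U g. openin Z U \<and> A \<subseteq> U \<and> continuous_map (subtopology Z U) L g \<and> (\<forall>x\<in>A. g x = f x)"
    by blast
qed

section \<open>Cones over compact ANRs\<close>

definition cone_height :: "('a \<times> real) option \<Rightarrow> real"
  where "cone_height z = (case z of None \<Rightarrow> 1 | Some p \<Rightarrow> snd p)"

text \<open>
  Only the values away from the vertex are meaningful.
\<close>

definition cone_base :: "('a \<times> real) option \<Rightarrow> 'a"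
  where "cone_base z = fst (the z)"

lemma cone_height_proj [simp]: "cone_height (cone_proj p) = snd p"
  by (simp add: cone_height_def cone_proj_def)

lemma cone_base_proj [simp]: "snd p \<noteq> 1 \<Longrightarrow> cone_base (cone_proj p) = fst p"
  by (simp add: cone_base_def cone_proj_def)

lemma cone_height_None [simp]: "cone_height None = 1"
  by (simp add: cone_height_def)

lemma topspace_cone_cases:
  assumes "z \<in> topspace (cone L)"
  obtains "z = None" | x t where "z = cone_proj (x, t)" "x \<in> topspace L" "0 \<le> t" "t < 1"
proof -
  consider "z = None" | x t where "z = cone_proj (x, t)" "x \<in> topspace L" "t \<in> {0..1}"
    using assms by (auto simp: topspace_cone)
  then show thesis
  proof cases
    case (2 x t)
    then show thesis
      using that by (cases "t = 1") (auto simp: cone_proj_def)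
  qed (use that in blast)
qed

lemma cone_proj_base_height:
  assumes "z \<in> topspace (cone L)"
  shows "cone_proj (cone_base z, cone_height z) = z"
  using assms by (cases rule: topspace_cone_cases) (auto simp: cone_proj_def[of "(_, 1)"])

lemma None_in_cone [simp]: "None \<in> topspace (cone L)"
  by (simp add: topspace_cone)

lemma cone_proj_in_cone: "x \<in> topspace L \<Longrightarrow> t \<in> {0..1} \<Longrightarrow> cone_proj (x, t) \<in> topspace (cone L)"
  by (auto simp: topspace_cone)

lemma continuous_map_from_cone:
  assumes "continuous_map (prod_topology L (top_of_set {0..1})) W (\<lambda>p. g (cone_proj p))"
    and "g None \<in> topspace W"
  shows "continuous_map (cone L) W g"
  unfolding continuous_map_def
proof (intro conjI allI impI)
  let ?P = "prod_topology L (top_of_set {0..1::real})"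
  show "g \<in> topspace (cone L) \<rightarrow> topspace W"
    using assms by (auto simp: topspace_cone continuous_map_def Pi_iff)
  fix U assume U: "openin W U"
  have "{p \<in> topspace ?P. cone_proj p \<in> {z \<in> topspace (cone L). g z \<in> U}} = {p \<in> topspace ?P. g (cone_proj p) \<in> U}"
    by (auto simp: topspace_cone)
  moreover have "openin ?P {p \<in> topspace ?P. g (cone_proj p) \<in> U}"
    using assms(1) U by (rule openin_continuous_map_preimage)
  ultimately show "openin (cone L) {z \<in> topspace (cone L). g z \<in> U}"
    unfolding openin_cone by (auto simp: topspace_cone)
qed

lemma continuous_map_cone_proj:
  "continuous_map (prod_topology L (top_of_set {0..1})) (cone L) cone_proj"
  by (auto simp: continuous_map_def topspace_cone openin_cone)

lemma continuous_map_cone_height: "continuous_map (cone L) (top_of_set {0..1}) cone_height"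
  by (rule continuous_map_from_cone) (auto intro: continuous_map_snd)

lemma openin_cone_below_vertex:
  assumes "openin L U"
  shows "openin (cone L) {z \<in> topspace (cone L). cone_height z < 1 \<and> cone_base z \<in> U}"
proof -
  let ?P = "prod_topology L (top_of_set {0..1::real})"
  have UL: "U \<subseteq> topspace L"
    using assms by (rule openin_subset)
  have "{p \<in> topspace ?P. cone_proj p \<in> {z \<in> topspace (cone L). cone_height z < 1 \<and> cone_base z \<in> U}}
      = U \<times> ({..<1} \<inter> {0..1})"
    using UL by (auto simp: cone_proj_in_cone)
  moreover have "openin ?P (U \<times> ({..<1} \<inter> {0..1}))"
    using assms by (simp add: openin_prod_Times_iff openin_subtopology) (metis lessThan_def open_lessThan)
  ultimately show ?thesis
    unfolding openin_cone by (auto simp: topspace_cone)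
qed

lemma continuous_map_cone_base:
  "continuous_map (subtopology (cone L) {z. cone_height z < 1}) L cone_base"
  unfolding continuous_map_def
proof (intro conjI allI impI)
  show "cone_base \<in> topspace (subtopology (cone L) {z. cone_height z < 1}) \<rightarrow> topspace L"
    by (auto elim!: topspace_cone_cases)
  fix U assume "openin L U"
  from openin_cone_below_vertex[OF this]
  show "openin (subtopology (cone L) {z. cone_height z < 1})
      {z \<in> topspace (subtopology (cone L) {z. cone_height z < 1}). cone_base z \<in> U}"
    by (auto simp: openin_subtopology intro!: exI)
qed

lemma compact_space_cone:
  assumes "compact_space L"
  shows "compact_space (cone L)"
proof -
  have "compact_space (prod_topology L (top_of_set {0..1::real}))"
    using assms by (simp add: compact_space_prod_topology compact_space_subtopology)
  then have "compactin (cone L) (cone_proj ` topspace (prod_topology L (top_of_set {0..1})))"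
    using continuous_map_cone_proj image_compactin unfolding compact_space_def by blast
  moreover have "compactin (cone L) {None}"
    by simp
  ultimately have "compactin (cone L) ({None} \<union> cone_proj ` topspace (prod_topology L (top_of_set {0..1})))"
    by (intro compactin_Un)
  then show ?thesis
    by (simp add: compact_space_def topspace_cone)
qed

lemma Hausdorff_space_cone:
  assumes "Hausdorff_space L"
  shows "Hausdorff_space (cone L)"
  unfolding Hausdorff_space_def
proof (intro allI impI)
  fix z w assume zw: "z \<in> topspace (cone L) \<and> w \<in> topspace (cone L) \<and> z \<noteq> w"
  show "\<exists>U V. openin (cone L) U \<and> openin (cone L) V \<and> z \<in> U \<and> w \<in> V \<and> disjnt U V"
  proof (cases "cone_height z = cone_height w")
    case True
    have "cone_height z \<le> 1" "cone_height z \<noteq> 1"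
      using zw True cone_proj_base_height[of z L] cone_proj_base_height[of w L] continuous_map_cone_height[of L]
      by (auto simp: continuous_map_def Pi_iff cone_proj_def)
    then have lt: "cone_height z < 1"
      by simp
    have "cone_base z \<noteq> cone_base w"
      using zw True cone_proj_base_height by metis
    moreover have "cone_base z \<in> topspace L" "cone_base w \<in> topspace L"
      using zw lt True continuous_map_cone_base[of L] by (auto simp: continuous_map_def Pi_iff)
    ultimately obtain U V where UV: "openin L U" "openin L V" "cone_base z \<in> U" "cone_base w \<in> V" "disjnt U V"
      using assms unfolding Hausdorff_space_def by metis
    show ?thesis
      using openin_cone_below_vertex[OF UV(1)] openin_cone_below_vertex[OF UV(2)] UV(3-5) zw lt True
      by (intro exI conjI) (assumption | force simp: disjnt_def)+
  next
    case False
    then obtain U V where UV: "open U" "open V" "cone_height z \<in> U" "cone_height w \<in> V" "U \<inter> V = {}"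
      using hausdorff by metis
    have h: "continuous_map (cone L) euclideanreal cone_height"
      using continuous_map_cone_height by (rule continuous_map_into_fulltopology)
    show ?thesis
      using openin_continuous_map_preimage[OF h, of U] openin_continuous_map_preimage[OF h, of V] UV zw
      by (intro exI[of _ "{z \<in> topspace (cone L). cone_height z \<in> U}"]
          exI[of _ "{z \<in> topspace (cone L). cone_height z \<in> V}"]) (auto simp: disjnt_def)
  qed
qed

text \<open>
  Because the cone over a compact space is compact, the sets of points above a given height form a
  neighbourhood base at the vertex.  Hence continuity at the vertex only depends on the height.
\<close>

lemma continuous_map_into_cone:
  assumes L: "compact_space L" and \<tau>: "continuous_map Z (top_of_set {0..1}) \<tau>"
    and p: "continuous_map (subtopology Z {z \<in> topspace Z. \<tau> z < 1}) L p"
  shows "continuous_map Z (cone L) (\<lambda>z. cone_proj (p z, \<tau> z))"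
  unfolding continuous_map_def
proof (intro conjI allI impI)
  let ?O = "{z \<in> topspace Z. \<tau> z < 1}"
  have \<tau>R: "continuous_map Z euclideanreal \<tau>" and \<tau>01: "\<And>z. z \<in> topspace Z \<Longrightarrow> \<tau> z \<in> {0..1}"
    using \<tau> by (auto simp: continuous_map_in_subtopology)
  have pL: "p z \<in> topspace L" if "z \<in> topspace Z" "\<tau> z < 1" for z
    using that p by (auto simp: continuous_map_def Pi_iff)
  show im: "(\<lambda>z. cone_proj (p z, \<tau> z)) \<in> topspace Z \<rightarrow> topspace (cone L)"
  proof
    fix z assume z: "z \<in> topspace Z"
    show "cone_proj (p z, \<tau> z) \<in> topspace (cone L)"
      using z \<tau>01[OF z] pL[OF z] by (cases "\<tau> z = 1") (auto simp: topspace_cone, simp add: cone_proj_def)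
  qed
  fix U assume U: "openin (cone L) U"
  let ?V = "{z \<in> topspace Z. cone_proj (p z, \<tau> z) \<in> U}"
  have O: "openin Z ?O"
    using openin_continuous_map_preimage[OF \<tau>R, of "{..<1}"] by simp
  have "continuous_map (subtopology Z ?O) (prod_topology L (top_of_set {0..1})) (\<lambda>z. (p z, \<tau> z))"
    using p continuous_map_from_subtopology[OF \<tau>] by (rule continuous_map_pairedI)
  then have "continuous_map (subtopology Z ?O) (cone L) (\<lambda>z. cone_proj (p z, \<tau> z))"
    using continuous_map_compose[OF _ continuous_map_cone_proj] by (simp add: o_def)
  from openin_continuous_map_preimage[OF this U]
  have "openin Z {z \<in> topspace (subtopology Z ?O). cone_proj (p z, \<tau> z) \<in> U}"
    using O openin_trans_full by blast
  moreover have "{z \<in> topspace (subtopology Z ?O). cone_proj (p z, \<tau> z) \<in> U} = ?V \<inter> ?O"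
    by auto
  ultimately have below: "openin Z (?V \<inter> ?O)"
    by simp
  show "openin Z ?V"
  proof (cases "None \<in> U")
    case False
    have "\<tau> z < 1" if "z \<in> ?V" for z
      using that \<tau>01[of z] False by (cases "\<tau> z = 1") (auto simp: cone_proj_def)
    then have "?V \<inter> ?O = ?V"
      by blast
    with below show ?thesis
      by simp
  next
    case True
    define C where "C = topspace (cone L) - U"
    have "compactin (cone L) C"
      using compact_space_cone[OF L] U by (auto simp: C_def intro: closedin_compact_space)
    then have "compactin euclideanreal (cone_height ` C)"
      using continuous_map_into_fulltopology[OF continuous_map_cone_height] by (rule image_compactin)
    then have cpt: "compact (cone_height ` C)"
      by simp
    have lt: "cone_height z < 1" if "z \<in> C" for z
      using that True by (auto simp: C_def elim: topspace_cone_cases)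
    have "\<exists>c<1. \<forall>z\<in>C. cone_height z \<le> c"
    proof (cases "C = {}")
      case True
      then show ?thesis
        by (auto intro: exI[of _ 0])
    next
      case False
      then obtain m where "m \<in> cone_height ` C" "\<forall>t\<in>cone_height ` C. t \<le> m"
        using compact_attains_sup[OF cpt] by blast
      with lt show ?thesis
        by auto
    qed
    then obtain c where c: "c < 1" "\<And>z. z \<in> C \<Longrightarrow> cone_height z \<le> c"
      by blast
    have "openin Z {z \<in> topspace Z. \<tau> z \<in> {c<..}}"
      using \<tau>R by (rule openin_continuous_map_preimage) simp
    moreover have "{z \<in> topspace Z. \<tau> z \<in> {c<..}} \<subseteq> ?V"
    proof
      fix z assume z: "z \<in> {z \<in> topspace Z. \<tau> z \<in> {c<..}}"
      then have "cone_proj (p z, \<tau> z) \<notin> C"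
        using c(2)[of "cone_proj (p z, \<tau> z)"] by auto
      then show "z \<in> ?V"
        using im z by (auto simp: C_def)
    qed
    moreover have "?V - ?O \<subseteq> {z \<in> topspace Z. \<tau> z \<in> {c<..}}"
      using c(1) by auto
    ultimately have "?V = (?V \<inter> ?O) \<union> {z \<in> topspace Z. \<tau> z \<in> {c<..}}"
      by blast
    with below \<open>openin Z {z \<in> topspace Z. \<tau> z \<in> {c<..}}\<close> show ?thesis
      by (metis (no_types, lifting) openin_Un)
  qed
qed

text \<open>
  The homotopy moves points towards the vertex: at time \<open>t\<close> every height has been raised to at least
  \<open>t\<close>.
\<close>

lemma homotopy_Z_set_cone:
  fixes L :: "'a topology"
  assumes L: "compact_space L"
  shows "homotopy_Z_set (cone L) (cone_proj ` (topspace L \<times> {0}))" (is "homotopy_Z_set _ ?T")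
proof -
  let ?CI = "prod_topology (cone L) (top_of_set {0..1::real})"
  have h: "continuous_map (cone L) euclideanreal cone_height"
    using continuous_map_cone_height by (rule continuous_map_into_fulltopology)
  have h01: "cone_height z \<in> {0..1}" if "z \<in> topspace (cone L)" for z
    using that continuous_map_cone_height[of L] by (auto simp: continuous_map_def Pi_iff)
  have "?T = {z \<in> topspace (cone L). cone_height z \<in> {0}}"
  proof (intro equalityI subsetI)
    fix z assume "z \<in> {z \<in> topspace (cone L). cone_height z \<in> {0}}"
    then show "z \<in> ?T"
      by (auto elim: topspace_cone_cases)
  qed (auto intro: cone_proj_in_cone)
  moreover have "closedin (cone L) {z \<in> topspace (cone L). cone_height z \<in> {0}}"
    using h by (rule closedin_continuous_map_preimage) simp
  ultimately have T: "closedin (cone L) ?T"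
    by simp
  define H :: "('a \<times> real) option \<times> real \<Rightarrow> ('a \<times> real) option"
    where "H = (\<lambda>q. cone_proj (cone_base (fst q), max (cone_height (fst q)) (snd q)))"
  have "continuous_map ?CI (cone L) H"
    unfolding H_def
  proof (rule continuous_map_into_cone[OF L])
    have "continuous_map ?CI euclideanreal (\<lambda>q. cone_height (fst q))" "continuous_map ?CI euclideanreal snd"
      using continuous_map_compose[OF continuous_map_fst h] continuous_map_into_fulltopology[OF continuous_map_snd]
      by (auto simp: o_def)
    then show "continuous_map ?CI (top_of_set {0..1}) (\<lambda>q. max (cone_height (fst q)) (snd q))"
      using h01 by (auto simp: continuous_map_in_subtopology le_max_iff_disj intro!: continuous_map_real_max)
    have "continuous_map (subtopology ?CI {q \<in> topspace ?CI. max (cone_height (fst q)) (snd q) < 1})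
        (subtopology (cone L) {z. cone_height z < 1}) fst"
      by (auto simp: continuous_map_in_subtopology intro!: continuous_map_from_subtopology continuous_map_fst)
    from continuous_map_compose[OF this continuous_map_cone_base]
    show "continuous_map (subtopology ?CI {q \<in> topspace ?CI. max (cone_height (fst q)) (snd q) < 1}) L
        (\<lambda>q. cone_base (fst q))"
      by (simp add: o_def)
  qed
  moreover have "H (z, 0) = z" if "z \<in> topspace (cone L)" for z
    using h01[OF that] cone_proj_base_height[OF that] by (simp add: H_def max_absorb1)
  moreover have "H (z, t) \<notin> ?T" if "t \<in> {0<..1}" for z t
  proof
    assume "H (z, t) \<in> ?T"
    then have "cone_height (H (z, t)) = 0"
      by auto
    then show False
      using that by (auto simp: H_def max_def split: if_splits)
  qed
  ultimately show ?thesis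
    using T unfolding homotopy_Z_set_def by blast
qed

lemma homeomorphic_cone_base:
  assumes "compact_space L" "Hausdorff_space L"
  shows "L homeomorphic_space subtopology (cone L) (cone_proj ` (topspace L \<times> {0}))"
proof -
  have "continuous_map L (prod_topology L (top_of_set {0..1})) (\<lambda>x. (x, 0::real))"
    by (intro continuous_map_pairedI) auto
  from continuous_map_compose[OF this continuous_map_cone_proj]
  have "continuous_map L (cone L) (\<lambda>x. cone_proj (x, 0))"
    by (simp add: o_def)
  then have "embedding_map L (cone L) (\<lambda>x. cone_proj (x, 0))"
    by (rule continuous_imp_embedding_map) (use assms in \<open>auto simp: Hausdorff_space_cone inj_on_def cone_proj_def\<close>)
  moreover have "(\<lambda>x. cone_proj (x, 0)) ` topspace L = cone_proj ` (topspace L \<times> {0})"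
    by auto
  ultimately show ?thesis
    using embedding_map_imp_homeomorphic_space by metis
qed

text \<open>
  Continuity where \<open>b\<close> vanishes comes from \<open>\<bar>b z * k z\<bar> \<le> b z\<close>.
\<close>

lemma continuous_map_extend_by_zero:
  assumes b: "continuous_map Z euclideanreal b" "\<And>z. z \<in> topspace Z \<Longrightarrow> 0 \<le> b z"
    and k: "continuous_map (subtopology Z {z \<in> topspace Z. 0 < b z}) euclideanreal k"
    and k01: "\<And>z. z \<in> topspace Z \<Longrightarrow> 0 < b z \<Longrightarrow> \<bar>k z\<bar> \<le> 1"
  shows "continuous_map Z euclideanreal (\<lambda>z. if 0 < b z then b z * k z else 0)"
proof -
  let ?O = "{z \<in> topspace Z. 0 < b z}" and ?h = "\<lambda>z. if 0 < b z then b z * k z else 0"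
  have O: "openin Z ?O"
    using openin_continuous_map_preimage[OF b(1), of "{0<..}"] by simp
  have "continuous_map (subtopology Z ?O) euclideanreal (\<lambda>z. b z * k z)"
    using continuous_map_from_subtopology[OF b(1)] k by (rule continuous_map_real_mult)
  then have hO: "continuous_map (subtopology Z ?O) euclideanreal ?h"
    by (rule continuous_map_eq) auto
  have "\<exists>V. openin Z V \<and> z \<in> V \<and> (\<forall>w\<in>V. ?h w \<in> ball (?h z) \<epsilon>)" if z: "z \<in> topspace Z" and \<epsilon>: "\<epsilon> > 0" for z \<epsilon>
  proof (cases "0 < b z")
    case True
    let ?V = "{w \<in> topspace (subtopology Z ?O). ?h w \<in> ball (?h z) \<epsilon>}"
    have "openin (subtopology Z ?O) ?V"
      using hO by (rule openin_continuous_map_preimage) simp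
    then have "openin Z ?V"
      using O openin_trans_full by blast
    moreover have "z \<in> ?V"
      using True z \<epsilon> by simp
    ultimately show ?thesis
      by blast
  next
    case False
    let ?V = "{w \<in> topspace Z. b w \<in> {..<\<epsilon>}}"
    have "openin Z ?V"
      using b(1) by (rule openin_continuous_map_preimage) simp
    moreover have "z \<in> ?V"
      using False z \<epsilon> by simp
    moreover have "?h w \<in> ball (?h z) \<epsilon>" if w: "w \<in> ?V" for w
    proof (cases "0 < b w")
      case True
      then have "\<bar>b w * k w\<bar> \<le> b w"
        using w k01[of w] mult_left_le[of "\<bar>k w\<bar>" "b w"] by (simp add: abs_mult)
      then show ?thesis
        using True False w by (simp add: dist_real_def)
    qed (use False \<epsilon> in auto)
    ultimately show ?thesis
      by blast
  qed
  then show ?thesis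
    using Met_TC.continuous_map_to_metric[of Z ?h] by simp
qed

text \<open>
  A map to the cone is determined by its height and by \<open>(1 - height) \<cdot> e (base)\<close>, which, unlike the
  base point itself, is continuous at the vertex as well; both extend by Tietze's theorem.  Below height
  1, division recovers a point \<open>y\<close> of the Hilbert cube, which is retracted to \<open>L\<close> if it lies in the
  neighbourhood \<open>U\<close>.  Raising the height to 1 as \<open>y\<close> leaves \<open>U\<close> sends all other points to the vertex.
\<close>

lemma absolute_extensor_cone:
  assumes L: "ANR_space L" "compact_space L" and e: "embedding_map L hilbert_cube e"
    and Z: "normal_space Z"
  shows "absolute_extensor (cone L) Z"
  unfolding absolute_extensor_def
proof (intro allI impI)
  fix A f assume A: "closedin Z A \<and> continuous_map (subtopology Z A) (cone L) f"
  then have AZ: "A \<subseteq> topspace Z"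
    by (simp add: closedin_subset)
  have fA: "f z \<in> topspace (cone L)" if "z \<in> A" for z
    using A that AZ by (auto simp: continuous_map_def Pi_iff)
  obtain U r where U: "openin hilbert_cube U" "e ` topspace L \<subseteq> U"
    and r: "continuous_map (subtopology hilbert_cube U) L r" "\<And>x. x \<in> topspace L \<Longrightarrow> r (e x) = x"
    using ANR_neighbourhood_retraction[OF L e] by metis
  have e_cont: "continuous_map L hilbert_cube e"
    using e by (metis continuous_map_in_subtopology embedding_map_def homeomorphic_imp_continuous_map)
  then have e01: "0 \<le> e x n" "e x n \<le> 1" if "x \<in> topspace L" for x n
    using that by (auto simp: continuous_map_hilbert_cube continuous_map_in_subtopology Pi_iff)
  have e_coord: "continuous_map L euclideanreal (\<lambda>x. e x n)" for n
    using e_cont by (auto simp: continuous_map_hilbert_cube continuous_map_in_subtopology)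
  have e_closed: "closedin hilbert_cube (e ` topspace L)"
    using e_cont L(2) Hausdorff_space_hilbert_cube
    by (metis compact_space_def compactin_imp_closedin image_compactin)
  have height_f: "continuous_map (subtopology Z A) euclideanreal (\<lambda>z. cone_height (f z))"
    using continuous_map_compose[OF conjunct2[OF A] continuous_map_into_fulltopology[OF continuous_map_cone_height]]
    by (simp add: o_def)
  have h01: "cone_height (f z) \<in> {0..1}" if "z \<in> A" for z
    using fA[OF that] continuous_map_cone_height[of L] by (auto simp: continuous_map_def Pi_iff)
  have "(\<lambda>z. cone_height (f z)) ` A \<subseteq> {0..1}"
    using h01 by blast
  then obtain \<sigma> where \<sigma>: "continuous_map Z euclideanreal \<sigma>" "\<And>z. z \<in> A \<Longrightarrow> \<sigma> z = cone_height (f z)"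
    "\<sigma> ` topspace Z \<subseteq> {0..1}"
    using Tietze_extension_closed_real_interval[OF Z conjunct1[OF A] height_f _ zero_le_one] by blast
  define c where "c z n = (1 - cone_height z) * e (cone_base z) n" for z n
  have "continuous_map (cone L) (top_of_set {0..1}) (\<lambda>z. c z n)" for n
  proof (rule continuous_map_from_cone)
    let ?P = "prod_topology L (top_of_set {0..1::real})"
    have "continuous_map ?P euclideanreal (\<lambda>p. e (fst p) n)" "continuous_map ?P euclideanreal snd"
      using continuous_map_compose[OF continuous_map_fst e_coord] continuous_map_into_fulltopology[OF continuous_map_snd]
      by (auto simp: o_def)
    then have "continuous_map ?P (top_of_set {0..1}) (\<lambda>p. (1 - snd p) * e (fst p) n)"
      using e01 by (auto simp: continuous_map_in_subtopology mult_le_one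
          intro!: continuous_map_real_mult continuous_map_diff)
    moreover have "(1 - snd p) * e (fst p) n = c (cone_proj p) n" for p
      by (cases "snd p = 1") (simp_all add: c_def)
    ultimately show "continuous_map ?P (top_of_set {0..1}) (\<lambda>p. c (cone_proj p) n)"
      by simp
  qed (simp add: c_def)
  then have "continuous_map (cone L) hilbert_cube c"
    by (simp add: continuous_map_hilbert_cube)
  from continuous_map_compose[OF conjunct2[OF A] this]
  obtain \<zeta> where \<zeta>: "continuous_map Z hilbert_cube \<zeta>" "\<And>z. z \<in> A \<Longrightarrow> \<zeta> z = c (f z)"
    using absolute_extensor_hilbert_cube[OF Z] A unfolding absolute_extensor_def by (metis comp_apply)
  let ?O = "{z \<in> topspace Z. 0 < 1 - \<sigma> z}"
  \<comment> \<open>The minimum keeps \<open>y\<close> in the cube; on \<open>A\<close> the quotient is at most 1 already.\<close>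
  define y where "y z n = min 1 (\<zeta> z n / (1 - \<sigma> z))" for z n
  have \<zeta>01: "0 \<le> \<zeta> z n" if "z \<in> topspace Z" for z n
    using that \<zeta>(1) by (auto simp: continuous_map_hilbert_cube continuous_map_in_subtopology Pi_iff)
  have y_cont: "continuous_map (subtopology Z ?O) hilbert_cube y"
    unfolding continuous_map_hilbert_cube
  proof
    fix n
    have "continuous_map (subtopology Z ?O) euclideanreal (\<lambda>z. \<zeta> z n)"
      using \<zeta>(1) by (auto simp: continuous_map_hilbert_cube intro: continuous_map_into_fulltopology continuous_map_from_subtopology)
    moreover have "continuous_map (subtopology Z ?O) euclideanreal (\<lambda>z. 1 - \<sigma> z)"
      using \<sigma>(1) by (intro continuous_map_diff continuous_map_from_subtopology) auto
    ultimately have "continuous_map (subtopology Z ?O) euclideanreal (\<lambda>z. y z n)"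
      unfolding y_def by (intro continuous_map_real_min continuous_map_real_divide) auto
    then show "continuous_map (subtopology Z ?O) (top_of_set {0..1}) (\<lambda>z. y z n)"
      using \<zeta>01 by (auto simp: continuous_map_in_subtopology y_def)
  qed
  have y_A: "y z = e (cone_base (f z)) \<and> cone_base (f z) \<in> topspace L" if z: "z \<in> A" "\<sigma> z < 1" for z
  proof -
    have base: "cone_base (f z) \<in> topspace L"
      using fA[OF z(1)] z(2) \<sigma>(2)[OF z(1)] by (cases rule: topspace_cone_cases) auto
    then have "y z n = e (cone_base (f z)) n" for n
      using z e01[OF base, of n] \<sigma>(2)[OF z(1)] by (simp add: y_def \<zeta>(2) c_def)
    with base show ?thesis
      by auto
  qed
  have "normal_space hilbert_cube"
    by (simp add: compact_Hausdorff_or_regular_imp_normal_space compact_space_hilbert_cube Hausdorff_space_hilbert_cube)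
  moreover have "closedin hilbert_cube (topspace hilbert_cube - U)"
    using U(1) by (rule openin_closedin_eq[THEN iffD1, THEN conjunct2])
  moreover have "disjnt (topspace hilbert_cube - U) (e ` topspace L)"
    using U(2) by (auto simp: disjnt_def)
  ultimately obtain \<kappa> where \<kappa>: "continuous_map hilbert_cube (top_of_set {0..1::real}) \<kappa>"
    "\<kappa> ` (topspace hilbert_cube - U) \<subseteq> {0}" "\<kappa> ` e ` topspace L \<subseteq> {1}"
    using Urysohn_lemma[of hilbert_cube "topspace hilbert_cube - U" "e ` topspace L" 0 1] e_closed by auto
  define k where "k z = \<kappa> (y z)" for z
  have k_cont: "continuous_map (subtopology Z ?O) (top_of_set {0..1}) k"
    using continuous_map_compose[OF y_cont \<kappa>(1)] by (simp add: k_def[abs_def] o_def)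
  then have k: "continuous_map (subtopology Z ?O) euclideanreal k" "\<And>z. z \<in> ?O \<Longrightarrow> k z \<in> {0..1}"
    by (auto simp: continuous_map_in_subtopology)
  define \<tau> where "\<tau> z = 1 - (if 0 < 1 - \<sigma> z then (1 - \<sigma> z) * k z else 0)" for z
  have "continuous_map Z euclideanreal (\<lambda>z. if 0 < 1 - \<sigma> z then (1 - \<sigma> z) * k z else 0)"
    using \<sigma> k by (intro continuous_map_extend_by_zero continuous_map_diff) (auto simp: image_subset_iff)
  then have "continuous_map Z euclideanreal \<tau>"
    unfolding \<tau>_def by (intro continuous_map_diff) auto
  moreover have "\<tau> z \<in> {0..1}" if "z \<in> topspace Z" for z
    using that k(2)[of z] \<sigma>(3) by (auto simp: \<tau>_def mult_le_one image_subset_iff)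
  ultimately have \<tau>: "continuous_map Z (top_of_set {0..1}) \<tau>"
    by (auto simp: continuous_map_in_subtopology)
  let ?N = "{z \<in> topspace Z. \<tau> z < 1}"
  have N: "?N \<subseteq> ?O" "y z \<in> U" if "z \<in> ?N" for z
  proof -
    show "?N \<subseteq> ?O"
      by (auto simp: \<tau>_def split: if_splits)
    then have "z \<in> ?O"
      using that by blast
    then have "y z \<in> topspace hilbert_cube" "k z \<noteq> 0"
      using that y_cont by (auto simp: \<tau>_def continuous_map_def Pi_iff simp del: topspace_hilbert_cube)
    then show "y z \<in> U"
      using \<kappa>(2) by (auto simp: k_def)
  qed
  have "continuous_map (subtopology Z ?N) (subtopology hilbert_cube U) y"
  proof (rule continuous_map_into_subtopology)
    show "continuous_map (subtopology Z ?N) hilbert_cube y"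
      using y_cont by (rule continuous_map_from_subtopology_mono) (auto simp: \<tau>_def split: if_splits)
    show "y \<in> topspace (subtopology Z ?N) \<rightarrow> U"
      using N(2) by auto
  qed
  from continuous_map_compose[OF this r(1)]
  have "continuous_map (subtopology Z ?N) L (\<lambda>z. r (y z))"
    by (simp add: o_def)
  then have "continuous_map Z (cone L) (\<lambda>z. cone_proj (r (y z), \<tau> z))"
    by (rule continuous_map_into_cone[OF L(2) \<tau>])
  moreover have "cone_proj (r (y z), \<tau> z) = f z" if z: "z \<in> A" for z
  proof (cases "\<sigma> z < 1")
    case True
    have "k z = 1"
      using y_A[OF z True] \<kappa>(3) by (auto simp: k_def)
    then have "\<tau> z = cone_height (f z)"
      using True \<sigma>(2)[OF z] by (simp add: \<tau>_def)
    then show ?thesis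
      using y_A[OF z True] r(2) cone_proj_base_height[OF fA[OF z]] by simp
  next
    case False
    then have "cone_height (f z) = 1" "\<tau> z = 1"
      using \<sigma>(2)[OF z] h01[OF z] by (auto simp: \<tau>_def)
    then show ?thesis
      using cone_proj_base_height[OF fA[OF z]] by (metis cone_proj_def snd_conv)
  qed
  ultimately show "\<exists>g. continuous_map Z (cone L) g \<and> (\<forall>z\<in>A. g z = f z)"
    by (intro exI conjI) auto
qed

section \<open>The Hilbert cube and the cone as compactifications with the same corona\<close>

theorem corollary4p2:
  fixes L :: "'l topology" and e :: "'l \<Rightarrow> nat \<Rightarrow> real" and X :: "'x topology"
  assumes "metrizable_space L" and "compact_space L" and "ANR_space L"
    and "embedding_map L hilbert_cube e" and "Z_set (e ` topspace L)"
    and "completely_regular_space X" and "Hausdorff_space X"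
    and "locally_compact_space X" and "Lindelof_space X"
  shows "(absolute_extensor L (stone_cech_remainder X) \<longleftrightarrow>
          proper_absolute_extensor
            (subtopology hilbert_cube (topspace hilbert_cube - e ` topspace L)) X) \<and>
         (proper_absolute_extensor
            (subtopology hilbert_cube (topspace hilbert_cube - e ` topspace L)) X \<longleftrightarrow>
          proper_absolute_extensor (cone_minus_base L) X)"
proof -
  interpret Lindelof_locally_compact_Tychonoff X
    using assms by unfold_locales
  have L: "Hausdorff_space L"
    using assms(1) by (rule metrizable_imp_Hausdorff_space)
  have ANE: "absolute_neighbourhood_extensor L \<beta>X"
    using absolute_neighbourhood_extensor_ANR[OF assms(3,2,4) normal_space_stone_cech] .
  have "absolute_extensor L (stone_cech_remainder X) \<longleftrightarrow>
      proper_absolute_extensor (subtopology hilbert_cube (topspace hilbert_cube - e ` topspace L)) X"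
    by (intro absolute_extensor_remainder_iff compact_space_hilbert_cube Hausdorff_space_hilbert_cube
        Z_set_imp_homotopy_Z_set absolute_extensor_hilbert_cube normal_S normal_space_stone_cech
        embedding_map_imp_homeomorphic_space assms ANE)
  moreover have "absolute_extensor L (stone_cech_remainder X) \<longleftrightarrow>
      proper_absolute_extensor (cone_minus_base L) X"
    unfolding cone_minus_base_def
    by (intro absolute_extensor_remainder_iff compact_space_cone Hausdorff_space_cone L
        homotopy_Z_set_cone absolute_extensor_cone[where e = e] normal_S normal_space_stone_cech
        homeomorphic_cone_base assms ANE)
  ultimately show ?thesis
    by blast
qed

end
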